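(* Let $a,b\in\mathbb{R}$ with $b\neq 0$, let $\delta\in(0,1)$, and let $V\in C^1_sC^{1,\delta}_y(\mathbb{R}^{3+1})$, $V=V(y,s)=(V_1,V_2,V_3)$, with $\Omega=\operatorname{curl}V\in C^1(\mathbb{R}^{3+1})$, be a time periodic solution, with period $S_0>0$, of $$\frac{\partial V}{\partial s}+aV+b(y\cdot\nabla)V+(V\cdot\nabla)V=-\nabla P,\qquad \operatorname{div}V=0,\qquad (y,s)\in\mathbb{R}^3\times\mathbb{R}.$$ Assume the following, according to the signs of $a+b$ and $b$: (i) If either $a+b>0$ and $b>0$, or $a+b<0$ and $b<0$: the origin $y=0$ is a point of local extremum of $V_i(\cdot,s)$ for all $i=1,2,3$ and all $s\in(0,S_0)$, and $V(0,s)=0$ for all $s\in(0,S_0)$. (ii) If either $a+b\leq 0$ and $b>0$, or $a+b\geq 0$ and $b<0$: the origin $y=0$ is a point of local extremum of $V_i(\cdot,s)$ for all $i=1,2,3$ and all $s\in(0,S_0)$, and there exist $\rho>0$ and $\beta>\frac{|a+b|}{|b|}+2$ such that $$V\in C^1_sC^{\beta}_y(B_\rho\times(0,S_0))\quad\text{and}\quad D^kV(0,s)=0\quad\text{for all } k=0,\dots,[\beta]\text{ and all } s\in(0,S_0).$$ Then $V=0$ on $\mathbb{R}^{3+1}$.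
   Context: Points of $\mathbb{R}^{3+1}=\mathbb{R}^3\times\mathbb{R}$ are written $(y,s)$; $\nabla$, $\operatorname{div}$, $\operatorname{curl}$ and $D^k$ (the collection of all partial derivatives of order $k$) are taken with respect to $y$. $B_\rho=\{y\in\mathbb{R}^3: |y|<\rho\}$ and $[\beta]$ is the integer part of $\beta$. $P=P(y,s)$ is a scalar pressure; the initial value $V(\cdot,0)=V_0$ is not otherwise prescribed. $V$ is a time periodic solution with period $S_0$ if, with its pressure $P$, it satisfies the system and $V(y,s)=V(y,s+S_0)$, $P(y,s)=P(y,s+S_0)$ for all $(y,s)\in\mathbb{R}^{3+1}$. $V\in C^1_sC^{1,\delta}_y(\mathbb{R}^{3+1})$ means that $V$ and $\partial_sV$ have continuous first-order spatial derivatives which are $\delta$-Hölder continuous in $y$ on every bounded subset of $\mathbb{R}^3$, uniformly for $s$ in bounded intervals; no boundedness or decay as $|y|\to\infty$ is assumed. $V\in C^1_sC^\beta_y(B_\rho\times(0,S_0))$ means that on $B_\rho\times(0,S_0)$ the functions $V$ and $\partial_sV$ have continuous bounded spatial derivatives up to order $[\beta]$, those of order $[\beta]$ being $(\beta-[\beta])$-Hölder continuous in $y$ uniformly in $s$ when $\beta$ is not an integer. *)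

theory Defs
  imports "HOL-Analysis.Analysis"
begin

text \<open>
  A field on space-time is a curried function \<open>W y s\<close> with \<open>y :: real^3\<close> and \<open>s :: real\<close>.
  The index type \<open>3\<close> has the elements \<open>1, 2, 3\<close> (where \<open>3 = 0\<close>).
\<close>

type_synonym vec3 = "real^3"

definition partial_y :: "3 \<Rightarrow> (vec3 \<Rightarrow> 'b) \<Rightarrow> vec3 \<Rightarrow> 'b::real_normed_vector" where
  "partial_y i f y = vector_derivative (\<lambda>t. f (y + t *\<^sub>R axis i 1)) (at 0)"

definition has_partial_y :: "3 \<Rightarrow> (vec3 \<Rightarrow> 'b::real_normed_vector) \<Rightarrow> vec3 \<Rightarrow> bool" where
  "has_partial_y i f y \<longleftrightarrow> (\<lambda>t. f (y + t *\<^sub>R axis i 1)) differentiable (at 0)"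

text \<open>
  The family \<open>D^k f\<close> consists of all \<open>partials_y is f\<close> with \<open>length is = k\<close>; the list gives the
  directions of differentiation, the last one being applied first.
\<close>

fun partials_y :: "3 list \<Rightarrow> (vec3 \<Rightarrow> 'b) \<Rightarrow> vec3 \<Rightarrow> 'b::real_normed_vector" where
  "partials_y [] f = f"
| "partials_y (i # is) f = partial_y i (partials_y is f)"

definition partial_s :: "(vec3 \<Rightarrow> real \<Rightarrow> 'b) \<Rightarrow> vec3 \<Rightarrow> real \<Rightarrow> 'b::real_normed_vector" where
  "partial_s W y s = vector_derivative (\<lambda>t. W y t) (at s)"

definition grad :: "(vec3 \<Rightarrow> real) \<Rightarrow> vec3 \<Rightarrow> vec3" where
  "grad p y = (\<chi> i. partial_y i p y)"

definition div_y :: "(vec3 \<Rightarrow> vec3) \<Rightarrow> vec3 \<Rightarrow> real" where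
  "div_y v y = (\<Sum>i\<in>UNIV. partial_y i v y $ i)"

definition curl :: "(vec3 \<Rightarrow> vec3) \<Rightarrow> vec3 \<Rightarrow> vec3" where
  "curl v y = vector
     [partial_y 2 v y $ 3 - partial_y 3 v y $ 2,
      partial_y 3 v y $ 1 - partial_y 1 v y $ 3,
      partial_y 1 v y $ 2 - partial_y 2 v y $ 1]"

text \<open>\<open>(w \<cdot> \<nabla>) v\<close> at the point \<open>y\<close>, for a vector \<open>w\<close>\<close>

definition advect :: "vec3 \<Rightarrow> (vec3 \<Rightarrow> vec3) \<Rightarrow> vec3 \<Rightarrow> vec3" where
  "advect w v y = (\<Sum>i\<in>UNIV. w $ i *\<^sub>R partial_y i v y)"

text \<open>
  Spatial derivatives of order at most \<open>m\<close> exist on \<open>U \<times> I\<close> (with \<open>U\<close> open) and are jointly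
  continuous there.
\<close>

definition spatial_C :: "nat \<Rightarrow> (vec3 \<Rightarrow> real \<Rightarrow> 'b::real_normed_vector) \<Rightarrow> vec3 set \<Rightarrow> real set \<Rightarrow> bool" where
  "spatial_C m W U I \<longleftrightarrow>
     (\<forall>is i. length is < m \<longrightarrow>
        (\<forall>y\<in>U. \<forall>s\<in>I. has_partial_y i (partials_y is (\<lambda>z. W z s)) y)) \<and>
     (\<forall>is. length is \<le> m \<longrightarrow>
        continuous_on (U \<times> I) (\<lambda>(y, s). partials_y is (\<lambda>z. W z s) y))"

definition spatial_bounded :: "nat \<Rightarrow> (vec3 \<Rightarrow> real \<Rightarrow> 'b::real_normed_vector) \<Rightarrow> vec3 set \<Rightarrow> real set \<Rightarrow> bool" where
  "spatial_bounded m W U I \<longleftrightarrow>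
     (\<forall>is. length is \<le> m \<longrightarrow>
        bounded ((\<lambda>(y, s). partials_y is (\<lambda>z. W z s) y) ` (U \<times> I)))"

text \<open>The derivatives of order \<open>m\<close> are \<open>\<gamma>\<close>-Hoelder in \<open>y \<in> U\<close>, uniformly in \<open>s \<in> I\<close>.\<close>

definition spatial_holder :: "nat \<Rightarrow> real \<Rightarrow> (vec3 \<Rightarrow> real \<Rightarrow> 'b::real_normed_vector) \<Rightarrow> vec3 set \<Rightarrow> real set \<Rightarrow> bool" where
  "spatial_holder m \<gamma> W U I \<longleftrightarrow>
     (\<forall>is. length is = m \<longrightarrow>
        (\<exists>C. \<forall>s\<in>I. \<forall>y\<in>U. \<forall>z\<in>U.
           norm (partials_y is (\<lambda>x. W x s) y - partials_y is (\<lambda>x. W x s) z) \<le> C * dist y z powr \<gamma>))"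

text \<open>
  \<open>C^1_s C^{1,\<delta>}_y\<close> on the whole of space-time: the Hoelder condition is only local.
\<close>

definition C1_s_C1_holder :: "real \<Rightarrow> (vec3 \<Rightarrow> real \<Rightarrow> vec3) \<Rightarrow> bool" where
  "C1_s_C1_holder \<delta> V \<longleftrightarrow>
     (\<forall>y s. (\<lambda>t. V y t) differentiable (at s)) \<and>
     (\<forall>W\<in>{V, partial_s V}.
        spatial_C 1 W UNIV UNIV \<and>
        (\<forall>A s0 s1. bounded A \<longrightarrow> spatial_holder 1 \<delta> W A {s0..s1}))"

text \<open>\<open>C^1_s C^\<beta>_y\<close> on \<open>U \<times> I\<close>, for \<open>\<beta> \<ge> 0\<close> and open \<open>U\<close>, \<open>I\<close>\<close>

definition C1_s_C_beta :: "real \<Rightarrow> (vec3 \<Rightarrow> real \<Rightarrow> vec3) \<Rightarrow> vec3 set \<Rightarrow> real set \<Rightarrow> bool" where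
  "C1_s_C_beta \<beta> V U I \<longleftrightarrow>
     (\<forall>y\<in>U. \<forall>s\<in>I. (\<lambda>t. V y t) differentiable (at s)) \<and>
     (\<forall>W\<in>{V, partial_s V}.
        spatial_C (nat \<lfloor>\<beta>\<rfloor>) W U I \<and>
        spatial_bounded (nat \<lfloor>\<beta>\<rfloor>) W U I \<and>
        (\<beta> \<notin> \<int> \<longrightarrow> spatial_holder (nat \<lfloor>\<beta>\<rfloor>) (\<beta> - \<lfloor>\<beta>\<rfloor>) W U I))"

definition C1_spacetime :: "(vec3 \<Rightarrow> real \<Rightarrow> vec3) \<Rightarrow> bool" where
  "C1_spacetime F \<longleftrightarrow>
     (\<exists>F' :: vec3 \<times> real \<Rightarrow> (vec3 \<times> real) \<Rightarrow>\<^sub>L vec3.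
        (\<forall>p. ((\<lambda>(y, s). F y s) has_derivative blinfun_apply (F' p)) (at p)) \<and>
        continuous_on UNIV F')"

text \<open>
  Classical solution. The differentiability clauses make the (total) derivative operators in the
  equations meaningful.
\<close>

definition is_solution :: "real \<Rightarrow> real \<Rightarrow> (vec3 \<Rightarrow> real \<Rightarrow> vec3) \<Rightarrow> (vec3 \<Rightarrow> real \<Rightarrow> real) \<Rightarrow> bool" where
  "is_solution a b V P \<longleftrightarrow>
     (\<forall>y s.
        (\<lambda>t. V y t) differentiable (at s) \<and>
        (\<lambda>z. V z s) differentiable (at y) \<and>
        (\<lambda>z. P z s) differentiable (at y) \<and>
        partial_s V y s + a *\<^sub>R V y s + b *\<^sub>R advect y (\<lambda>z. V z s) y
          + advect (V y s) (\<lambda>z. V z s) y = - grad (\<lambda>z. P z s) y \<and>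
        div_y (\<lambda>z. V z s) y = 0)"

definition time_periodic_solution ::
  "real \<Rightarrow> real \<Rightarrow> real \<Rightarrow> (vec3 \<Rightarrow> real \<Rightarrow> vec3) \<Rightarrow> (vec3 \<Rightarrow> real \<Rightarrow> real) \<Rightarrow> bool" where
  "time_periodic_solution a b S0 V P \<longleftrightarrow>
     is_solution a b V P \<and>
     (\<forall>y s. V y s = V y (s + S0) \<and> P y s = P y (s + S0))"

definition local_extremum :: "(vec3 \<Rightarrow> real) \<Rightarrow> vec3 \<Rightarrow> bool" where
  "local_extremum f x \<longleftrightarrow>
     (\<forall>\<^sub>F y in nhds x. f y \<le> f x) \<or> (\<forall>\<^sub>F y in nhds x. f x \<le> f y)"

end

theory Submission
  imports Defs
begin

text \<open>
  Since \<open>(y \<cdot> \<nabla>)V = \<Omega> \<times> y + \<nabla>(y \<cdot> V) - V\<close> and \<open>(V \<cdot> \<nabla>)V = \<Omega> \<times> V + \<nabla>|V|\<^sup>2/2\<close>, the equation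
  reads \<open>\<partial>\<^sub>sV + (a - b)V + \<Omega> \<times> (by + V) = -\<nabla>Q\<close>, whose curl only involves first derivatives of
  \<open>V\<close>, \<open>\<partial>\<^sub>sV\<close> and \<open>\<Omega>\<close>; this gives the vorticity equation although \<open>V\<close> need not be twice
  differentiable. Near the origin the field \<open>by + V\<close> points outwards (inwards if \<open>b < 0\<close>), so that, by a
  maximum principle for \<open>|\<Omega>|\<^sup>2 |y|\<^sup>-\<^sup>2\<^sup>k\<close> over a ball and a period, \<open>\<Omega>\<close> vanishes near the origin:
  \<open>k = 0\<close> suffices in case (i), and in case (ii) the flatness of \<open>V\<close> allows \<open>k > |a + b| / |b|\<close>.
  There \<open>V\<close> is free of divergence and curl, hence harmonic, and the local extremum forces \<open>V = 0\<close>.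
  Once \<open>V = 0\<close> in a ball, every \<open>k\<close> is admissible, so \<open>\<Omega> = 0\<close> in a slightly larger ball, and \<open>V = 0\<close>
  there by unique continuation; hence the radius of the ball is unbounded.
\<close>

section \<open>Iterated line integrals and mixed derivatives\<close>

text \<open>The regularity shapes the tools. Likewise harmonicity is never stated through a
  Laplacian: the first-order system div U = 0, curl U = 0 is integrated against a radial weight,
  which yields both a mean value property and unique continuation. The thresholds come from the
  linear part of the transport. Near the origin, along by + V, the length |y| grows at rate about b
  and |\<Omega>|^2 at rate about -2(a + b), so |\<Omega>|^2 |y|^(-2k) grows at rate about -2(a + b +
  kb). The maximum principle needs sgn(b)(a + b) + k|b| > 0, which k = 0 satisfies exactly when a +
  b and b have the same sign. It also needs |\<Omega>| = o(|y|^k). Of the 2 in \<beta> > |a + b|/|b|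
  + 2, one unit pays for rounding \<beta> down to an integer, the other for passing from V to its
  first derivatives. Assumptions on the open interval (0, S0) reach all times by continuity and
  periodicity.\<close>

definition has_dir_deriv :: "('a::real_normed_vector \<Rightarrow> real) \<Rightarrow> 'a \<Rightarrow> ('a \<Rightarrow> real) \<Rightarrow> bool" where
  "has_dir_deriv f e g \<longleftrightarrow> (\<forall>p. ((\<lambda>t. f (p + t *\<^sub>R e)) has_real_derivative g p) (at 0))"

definition line_int :: "real \<Rightarrow> 'a::real_normed_vector \<Rightarrow> ('a \<Rightarrow> real) \<Rightarrow> 'a \<Rightarrow> real" where
  "line_int h e f p = integral {0..h} (\<lambda>t. f (p + t *\<^sub>R e))"

lemma has_dir_deriv_shift:
  assumes "has_dir_deriv f e g"
  shows "((\<lambda>t. f (p + t *\<^sub>R e)) has_real_derivative g (p + t *\<^sub>R e)) (at t)"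
proof -
  have "((\<lambda>u. f ((p + t *\<^sub>R e) + u *\<^sub>R e)) has_real_derivative g (p + t *\<^sub>R e)) (at 0)"
    using assms by (simp add: has_dir_deriv_def)
  then have "((\<lambda>u. f (p + (u + t) *\<^sub>R e)) has_real_derivative g (p + t *\<^sub>R e)) (at 0)"
    by (simp add: algebra_simps)
  then show ?thesis
    using DERIV_shift[of "\<lambda>u. f (p + u *\<^sub>R e)" "g (p + t *\<^sub>R e)" 0 t] by simp
qed

lemma continuous_on_line_int:
  fixes f :: "'a::real_normed_vector \<Rightarrow> real"
  assumes "continuous_on UNIV f"
  shows "continuous_on UNIV (line_int h e f)"
proof -
  have "continuous_on (UNIV \<times> cbox 0 h) (\<lambda>(p, t). f (p + t *\<^sub>R e))"
    unfolding split_beta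
    by (rule continuous_on_compose2[OF assms]) (auto intro!: continuous_intros)
  from integral_continuous_on_param[OF this] show ?thesis
    unfolding line_int_def[abs_def] by simp
qed

lemma integrable_line:
  fixes f :: "'a::real_normed_vector \<Rightarrow> real"
  assumes "continuous_on UNIV f"
  shows "(\<lambda>t. f (p + t *\<^sub>R e)) integrable_on {0..h}"
  by (rule integrable_continuous_real, rule continuous_on_compose2[OF assms])
     (auto intro!: continuous_intros)

lemma line_int_commute:
  fixes f :: "'a::real_normed_vector \<Rightarrow> real"
  assumes "continuous_on UNIV f"
  shows "line_int h e (line_int k d f) p = line_int k d (line_int h e f) p"
proof -
  have "continuous_on (cbox (0,0) (h,k)) (\<lambda>(t, u). f (p + t *\<^sub>R e + u *\<^sub>R d))"
    unfolding split_beta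
    by (rule continuous_on_compose2[OF assms]) (auto intro!: continuous_intros)
  from integral_swap_continuous[OF this] show ?thesis
    by (simp add: line_int_def add_ac)
qed

lemma line_int_deriv:
  assumes "has_dir_deriv f e g" "h \<ge> 0"
  shows "line_int h e g p = f (p + h *\<^sub>R e) - f p"
proof -
  have "((\<lambda>t. g (p + t *\<^sub>R e)) has_integral f (p + h *\<^sub>R e) - f (p + 0 *\<^sub>R e)) {0..h}"
    using assms(2) has_dir_deriv_shift[OF assms(1)]
    by (intro fundamental_theorem_of_calculus)
       (auto simp: has_real_derivative_iff_has_vector_derivative[symmetric]
             intro: DERIV_subset)
  then show ?thesis by (simp add: line_int_def integral_unique)
qed

lemma line_int_add:
  fixes f g :: "'a::real_normed_vector \<Rightarrow> real"
  assumes "continuous_on UNIV f" "continuous_on UNIV g"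
  shows "line_int h e (\<lambda>p. f p + g p) p = line_int h e f p + line_int h e g p"
  unfolding line_int_def by (intro integral_add integrable_line assms)

lemma line_int_diff:
  fixes f g :: "'a::real_normed_vector \<Rightarrow> real"
  assumes "continuous_on UNIV f" "continuous_on UNIV g"
  shows "line_int h e (\<lambda>p. f p - g p) p = line_int h e f p - line_int h e g p"
  unfolding line_int_def by (intro integral_diff integrable_line assms)

lemma line_int_translate: "line_int h e (\<lambda>p. f (p + c)) p = line_int h e f (p + c)"
  by (simp add: line_int_def add_ac)

text \<open>Turns integrated identities back into pointwise ones: the one-sided derivative of the
  integral at h = 0 is \<open>g p\<close>.\<close>

lemma line_int_eq_0D:
  fixes g :: "'a::real_normed_vector \<Rightarrow> real"
  assumes g: "continuous_on UNIV g" and 0: "\<And>h p. h > 0 \<Longrightarrow> line_int h e g p = 0"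
  shows "g p = 0"
proof -
  let ?u = "\<lambda>t. g (p + t *\<^sub>R e)"
  have c: "continuous_on {0..1} ?u"
    by (rule continuous_on_compose2[OF g]) (auto intro!: continuous_intros)
  have u: "((\<lambda>h. integral {0..h} ?u) has_vector_derivative ?u 0) (at 0 within cbox 0 1)"
    using integral_has_vector_derivative[OF c, of 0] by simp
  have z: "integral {0..h} ?u = 0" if "h \<in> {0..1}" for h
    using that 0[of h p] by (cases "h = 0") (auto simp: line_int_def)
  have "((\<lambda>h. integral {0..h} ?u) has_vector_derivative 0) (at 0 within cbox 0 1)"
    by (rule has_vector_derivative_transform[where f="\<lambda>_. 0"]) (simp_all add: z)
  from vector_derivative_unique_within_closed_interval[OF _ _ u this] have "?u 0 = 0"
    by simp
  then show ?thesis by simp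
qed

text \<open>Stokes' theorem on the parallelogram spanned by \<open>h *\<^sub>R e\<close> and
  \<open>k *\<^sub>R d\<close>: each derivative is integrated out along its own direction, after an
  exchange of the integrals for \<open>eb\<close>.\<close>

lemma line_int_line_int_curl:
  fixes A B :: "'a::real_normed_vector \<Rightarrow> real"
  assumes A: "has_dir_deriv A d da" and B: "has_dir_deriv B e eb"
    and c: "continuous_on UNIV A" "continuous_on UNIV B" "continuous_on UNIV da" "continuous_on UNIV eb"
    and hk: "h \<ge> 0" "k \<ge> 0"
  shows "line_int h e (line_int k d (\<lambda>p. eb p - da p)) p =
    (line_int k d B (p + h *\<^sub>R e) - line_int k d B p) -
    (line_int h e A (p + k *\<^sub>R d) - line_int h e A p)"
proof -
  have shift: "continuous_on UNIV (\<lambda>p. f (p + v))" if "continuous_on UNIV f" for f :: "'a \<Rightarrow> real" and v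
    by (rule continuous_on_compose2[OF that]) (auto intro!: continuous_intros)
  have "line_int k d (\<lambda>p. eb p - da p) = (\<lambda>p. line_int k d eb p - (A (p + k *\<^sub>R d) - A p))"
    using line_int_deriv[OF A hk(2)] by (intro ext) (simp add: line_int_diff c)
  then have "line_int h e (line_int k d (\<lambda>p. eb p - da p)) p =
      line_int h e (line_int k d eb) p - (line_int h e A (p + k *\<^sub>R d) - line_int h e A p)"
    by (simp add: line_int_diff line_int_translate continuous_on_line_int shift c continuous_on_diff)
  also have "line_int h e (line_int k d eb) p = line_int k d (line_int h e eb) p"
    by (rule line_int_commute) (rule c)
  also have "line_int h e eb = (\<lambda>p. B (p + h *\<^sub>R e) - B p)"
    by (intro ext line_int_deriv[OF B hk(1)])
  also have "line_int k d \<dots> p = line_int k d B (p + h *\<^sub>R e) - line_int k d B p"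
    by (simp add: line_int_diff line_int_translate shift c)
  finally show ?thesis .
qed

text \<open>No second derivatives of \<open>A\<close> are assumed to exist: integrated over a parallelepiped, the
  identity says that the circulations around its faces cancel along the edges.\<close>

lemma div_curl_eq_0:
  fixes A1 A2 A3 :: "'a::real_normed_vector \<Rightarrow> real"
  assumes A1: "has_dir_deriv A1 e2 a21" "has_dir_deriv A1 e3 a31"
    and A2: "has_dir_deriv A2 e3 a32" "has_dir_deriv A2 e1 a12"
    and A3: "has_dir_deriv A3 e1 a13" "has_dir_deriv A3 e2 a23"
    and cA: "continuous_on UNIV A1" "continuous_on UNIV A2" "continuous_on UNIV A3"
    and ca: "continuous_on UNIV a21" "continuous_on UNIV a31" "continuous_on UNIV a32"
      "continuous_on UNIV a12" "continuous_on UNIV a13" "continuous_on UNIV a23"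
    and g: "has_dir_deriv (\<lambda>p. a23 p - a32 p) e1 g1" "has_dir_deriv (\<lambda>p. a31 p - a13 p) e2 g2"
      "has_dir_deriv (\<lambda>p. a12 p - a21 p) e3 g3"
    and cg: "continuous_on UNIV g1" "continuous_on UNIV g2" "continuous_on UNIV g3"
  shows "g1 p + g2 p + g3 p = 0"
proof -
  have shift: "continuous_on UNIV (\<lambda>p. f (p + v))" if "continuous_on UNIV f" for f :: "'a \<Rightarrow> real" and v
    by (rule continuous_on_compose2[OF that]) (auto intro!: continuous_intros)
  \<comment> \<open>Integrating \<open>g\<close> along \<open>d1\<close> leaves the difference of
    the fluxes of \<open>w\<close> through two opposite faces.\<close>
  have flux: "line_int h2 d2 (line_int h3 d3 (line_int h1 d1 g)) p =
      line_int h2 d2 (line_int h3 d3 w) (p + h1 *\<^sub>R d1) - line_int h2 d2 (line_int h3 d3 w) p"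
    if w: "has_dir_deriv w d1 g" "continuous_on UNIV w" "h1 \<ge> 0"
    for h1 h2 h3 p and d1 d2 d3 :: 'a and w g
  proof -
    have "line_int h1 d1 g = (\<lambda>p. w (p + h1 *\<^sub>R d1) - w p)"
      by (intro ext line_int_deriv w)
    moreover have "line_int h3 d3 (\<lambda>p. w (p + h1 *\<^sub>R d1) - w p) =
        (\<lambda>p. line_int h3 d3 w (p + h1 *\<^sub>R d1) - line_int h3 d3 w p)"
      by (intro ext) (simp add: line_int_diff line_int_translate shift w)
    ultimately show ?thesis
      by (simp add: line_int_diff line_int_translate shift continuous_on_line_int w)
  qed
  have comm: "line_int h e (line_int k d f) = line_int k d (line_int h e f)"
    if "continuous_on UNIV f" for h k and d e :: 'a and f
    by (intro ext line_int_commute that)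
  have cint: "continuous_on UNIV (line_int h e f)" if "continuous_on UNIV f" for h and e :: 'a and f
    by (intro continuous_on_line_int that)
  have zero: "line_int h1 e1 (line_int h2 e2 (line_int h3 e3 (\<lambda>p. g1 p + g2 p + g3 p))) p = 0"
    if h: "h1 > 0" "h2 > 0" "h3 > 0" for h1 h2 h3 p
  proof -
    have "line_int h3 e3 (\<lambda>p. g1 p + g2 p + g3 p) =
        (\<lambda>p. line_int h3 e3 g1 p + line_int h3 e3 g2 p + line_int h3 e3 g3 p)"
      by (intro ext) (simp add: line_int_add cg continuous_on_add)
    moreover have "line_int h2 e2 \<dots> = (\<lambda>p. line_int h2 e2 (line_int h3 e3 g1) p +
        line_int h2 e2 (line_int h3 e3 g2) p + line_int h2 e2 (line_int h3 e3 g3) p)"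
      by (intro ext) (simp add: line_int_add cg cint continuous_on_add)
    ultimately have "line_int h1 e1 (line_int h2 e2 (line_int h3 e3 (\<lambda>p. g1 p + g2 p + g3 p))) p =
        line_int h1 e1 (line_int h2 e2 (line_int h3 e3 g1)) p +
        line_int h1 e1 (line_int h2 e2 (line_int h3 e3 g2)) p +
        line_int h1 e1 (line_int h2 e2 (line_int h3 e3 g3)) p"
      by (simp add: line_int_add cg cint continuous_on_add)
    \<comment> \<open>Each summand needs its own direction of differentiation innermost and the
      other two in cyclic order, as in \<open>line_int_line_int_curl\<close>; for \<open>g3\<close>
      the order is already right.\<close>
    also have "line_int h1 e1 (line_int h2 e2 (line_int h3 e3 g1)) =
        line_int h2 e2 (line_int h3 e3 (line_int h1 e1 g1))"
      by (simp only: comm[OF cint[OF cg(1)], of h1 e1 h2 e2] comm[OF cg(1), of h1 e1 h3 e3])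
    also have "line_int h1 e1 (line_int h2 e2 (line_int h3 e3 g2)) =
        line_int h3 e3 (line_int h1 e1 (line_int h2 e2 g2))"
      by (simp only: comm[OF cg(2), of h2 e2 h3 e3] comm[OF cint[OF cg(2)], of h1 e1 h3 e3]
          comm[OF cg(2), of h1 e1 h2 e2])
    finally show ?thesis
      using h
      by (simp add: flux[OF g(1)] flux[OF g(2)] flux[OF g(3)] ca continuous_on_diff
          line_int_line_int_curl[OF A2(1) A3(2)] line_int_line_int_curl[OF A3(1) A1(2)]
          line_int_line_int_curl[OF A1(1) A2(2)] cA add_ac)
  qed
  have c: "continuous_on UNIV (\<lambda>p. g1 p + g2 p + g3 p)"
    by (intro continuous_intros cg)
  have z2: "line_int h2 e2 (line_int h3 e3 (\<lambda>p. g1 p + g2 p + g3 p)) p = 0" if "h2 > 0" "h3 > 0" for h2 h3 p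
    by (rule line_int_eq_0D[where e=e1]) (auto intro!: cint c zero that)
  have z3: "line_int h3 e3 (\<lambda>p. g1 p + g2 p + g3 p) p = 0" if "h3 > 0" for h3 p
    by (rule line_int_eq_0D[where e=e2]) (auto intro!: cint c z2 that)
  show ?thesis
    by (rule line_int_eq_0D[where e=e3 and g="\<lambda>p. g1 p + g2 p + g3 p"]) (auto intro!: c z3)
qed

lemma has_dir_deriv_const: "has_dir_deriv (\<lambda>_. c) e (\<lambda>_. 0)"
  by (simp add: has_dir_deriv_def)

text \<open>Schwarz's theorem when only the two mixed derivatives are known. It is
  \<open>div_curl_eq_0\<close> for the field (q, 0, 0) with first direction 0, whose curl is (0, g,
  -f).\<close>

lemma mixed_derivs_eq:
  fixes q :: "'a::real_normed_vector \<Rightarrow> real"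
  assumes q: "has_dir_deriv q e f" "has_dir_deriv q d g"
    and m: "has_dir_deriv f d fd" "has_dir_deriv g e ge"
    and c: "continuous_on UNIV q" "continuous_on UNIV f" "continuous_on UNIV g"
      "continuous_on UNIV fd" "continuous_on UNIV ge"
  shows "fd p = ge p"
proof -
  have "has_dir_deriv (\<lambda>p. 0 - f p) d (\<lambda>p. - fd p)"
    using m(1) by (auto simp: has_dir_deriv_def intro!: derivative_eq_intros)
  then have "0 + ge p + - fd p = 0"
    using m(2)
    by (intro div_curl_eq_0[where ?A1.0=q and ?A2.0="\<lambda>_. 0" and ?A3.0="\<lambda>_. 0" and ?e1.0=0
          and ?e2.0=e and ?e3.0=d and ?g1.0="\<lambda>_. 0" and ?g2.0=ge and ?g3.0="\<lambda>p. - fd p"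
          and ?a12.0="\<lambda>_. 0" and ?a13.0="\<lambda>_. 0" and ?a23.0="\<lambda>_. 0" and ?a32.0="\<lambda>_. 0"
          and ?a21.0=f and ?a31.0=g])
       (auto simp: has_dir_deriv_const intro!: q c continuous_intros)
  then show ?thesis by simp
qed

text \<open>This is \<open>div_curl_eq_0\<close> for the field (v1, v2, 0) with third direction d,
  whose curl is (-w2, w1, a12 - a21). With d the time direction it says that the time derivative of
  \<Omega> is the curl of the time derivative of V.\<close>

lemma curl_deriv_commute:
  fixes v1 v2 :: "'a::real_normed_vector \<Rightarrow> real"
  assumes v: "has_dir_deriv v2 e1 a12" "has_dir_deriv v1 e2 a21"
      "has_dir_deriv v1 d w1" "has_dir_deriv v2 d w2"
    and w: "has_dir_deriv w2 e1 b12" "has_dir_deriv w1 e2 b21"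
    and g: "has_dir_deriv (\<lambda>p. a12 p - a21 p) d g"
    and c: "continuous_on UNIV v1" "continuous_on UNIV v2" "continuous_on UNIV a12"
      "continuous_on UNIV a21" "continuous_on UNIV w1" "continuous_on UNIV w2"
      "continuous_on UNIV b12" "continuous_on UNIV b21" "continuous_on UNIV g"
  shows "g p = b12 p - b21 p"
proof -
  have "has_dir_deriv (\<lambda>p. 0 - w2 p) e1 (\<lambda>p. - b12 p)"
    using w(1) by (auto simp: has_dir_deriv_def intro!: derivative_eq_intros)
  then have "- b12 p + b21 p + g p = 0"
    using w(2)
    by (intro div_curl_eq_0[where ?A1.0=v1 and ?A2.0=v2 and ?A3.0="\<lambda>_. 0" and ?e1.0=e1
          and ?e2.0=e2 and ?e3.0=d and ?g1.0="\<lambda>p. - b12 p" and ?g2.0=b21 and ?g3.0=g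
          and ?a12.0=a12 and ?a13.0="\<lambda>_. 0" and ?a23.0="\<lambda>_. 0" and ?a32.0=w2
          and ?a21.0=a21 and ?a31.0=w1])
       (auto simp: has_dir_deriv_const intro!: v c g continuous_intros)
  then show ?thesis by simp
qed

section \<open>The vorticity equation\<close>

lemma has_dir_deriv_slice:
  "has_dir_deriv f (e, 0) g \<Longrightarrow> has_dir_deriv (\<lambda>y. f (y, s)) e (\<lambda>y. g (y, s))"
  unfolding has_dir_deriv_def by (auto dest: spec[of _ "(_, s)"])

lemma has_dir_deriv_has_derivative:
  assumes "\<And>p. (f has_derivative f' p) (at p)"
  shows "has_dir_deriv f e (\<lambda>p. f' p e)"
  unfolding has_dir_deriv_def
proof
  fix p
  have "((\<lambda>t. p + t *\<^sub>R e) has_derivative (\<lambda>t. t *\<^sub>R e)) (at 0)"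
    by (auto intro!: derivative_eq_intros)
  from has_derivative_compose[OF this, of f "f' p"]
  have "((\<lambda>t. f (p + t *\<^sub>R e)) has_derivative (\<lambda>t. f' p (t *\<^sub>R e))) (at 0)"
    using assms[of p] by simp
  moreover have "(\<lambda>t. f' p (t *\<^sub>R e)) = (*) (f' p e)"
    using linear_scale[OF has_derivative_linear[OF assms[of p]]] by (auto simp: mult.commute)
  ultimately show "((\<lambda>t. f (p + t *\<^sub>R e)) has_real_derivative f' p e) (at 0)"
    by (simp add: has_field_derivative_def)
qed

lemma has_dir_deriv_partial_y:
  fixes W :: "vec3 \<Rightarrow> real \<Rightarrow> vec3"
  assumes "\<And>y s. has_partial_y i (\<lambda>z. W z s) y"
  shows "has_dir_deriv (\<lambda>p. W (fst p) (snd p) $ k) (axis i 1, 0)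
    (\<lambda>p. partial_y i (\<lambda>z. W z (snd p)) (fst p) $ k)"
  unfolding has_dir_deriv_def
proof
  fix p :: "vec3 \<times> real"
  obtain y s where p: "p = (y, s)" by force
  have "((\<lambda>t. W (y + t *\<^sub>R axis i 1) s) has_vector_derivative partial_y i (\<lambda>z. W z s) y) (at 0)"
    using assms[of s y] unfolding has_partial_y_def partial_y_def by (simp add: vector_derivative_works)
  from bounded_linear.has_vector_derivative[OF bounded_linear_vec_nth this, of k]
  show "((\<lambda>t. W (fst (p + t *\<^sub>R (axis i 1, 0))) (snd (p + t *\<^sub>R (axis i 1, 0))) $ k)
      has_real_derivative partial_y i (\<lambda>z. W z (snd p)) (fst p) $ k) (at 0)"
    by (simp add: p has_real_derivative_iff_has_vector_derivative)
qed

lemma has_dir_deriv_partial_s: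
  fixes W :: "vec3 \<Rightarrow> real \<Rightarrow> vec3"
  assumes "\<And>y s. (\<lambda>t. W y t) differentiable (at s)"
  shows "has_dir_deriv (\<lambda>p. W (fst p) (snd p) $ k) (0, 1) (\<lambda>p. partial_s W (fst p) (snd p) $ k)"
  unfolding has_dir_deriv_def
proof
  fix p :: "vec3 \<times> real"
  obtain y s where p: "p = (y, s)" by force
  have "((\<lambda>t. W y t) has_vector_derivative partial_s W y s) (at s)"
    using assms[of y s] unfolding partial_s_def by (simp add: vector_derivative_works)
  from bounded_linear.has_vector_derivative[OF bounded_linear_vec_nth this, of k]
  have "((\<lambda>t. W y t $ k) has_real_derivative partial_s W y s $ k) (at (0 + s))"
    by (simp add: has_real_derivative_iff_has_vector_derivative)
  from this[unfolded DERIV_shift]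
  show "((\<lambda>t. W (fst (p + t *\<^sub>R (0, 1))) (snd (p + t *\<^sub>R (0, 1))) $ k)
      has_real_derivative partial_s W (fst p) (snd p) $ k) (at 0)"
    by (simp add: p add.commute)
qed

lemma curl_nth:
  "curl v y $ 1 = partial_y 2 v y $ 3 - partial_y 3 v y $ 2"
  "curl v y $ 2 = partial_y 3 v y $ 1 - partial_y 1 v y $ 3"
  "curl v y $ 3 = partial_y 1 v y $ 2 - partial_y 2 v y $ 1"
  by (simp_all add: curl_def)

text \<open>The left-hand side is the derivative of \<Omega> along the space-time vector (by + V,
  1), the form needed for the chain rule in the maximum principle; the last term is vortex
  stretching.\<close>

lemma vorticity_equation:
  fixes V :: "vec3 \<Rightarrow> real \<Rightarrow> vec3"
  assumes V: "C1_s_C1_holder \<delta> V" and sol: "is_solution a b V P"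
    and Om: "\<And>p. ((\<lambda>(y, s). curl (\<lambda>z. V z s) y) has_derivative blinfun_apply (Om' p)) (at p)"
    and Om'_cont: "continuous_on UNIV Om'"
  shows "Om' (y, s) (b *\<^sub>R y + V y s, 1) =
    - (a + b) *\<^sub>R curl (\<lambda>z. V z s) y + advect (curl (\<lambda>z. V z s) y) (\<lambda>z. V z s) y"
proof -
  define v where "v k p = V (fst p) (snd p) $ k" for k p
  define w where "w k p = partial_s V (fst p) (snd p) $ k" for k p
  define d where "d i k p = partial_y i (\<lambda>z. V z (snd p)) (fst p) $ k" for i k p
  define dw where "dw i k p = partial_y i (\<lambda>z. partial_s V z (snd p)) (fst p) $ k" for i k p
  define o' where "o' k p = curl (\<lambda>z. V z (snd p)) (fst p) $ k" for k p
  define g where "g e k p = Om' p e $ k" for e k p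
  have sC: "spatial_C 1 V UNIV UNIV" "spatial_C 1 (partial_s V) UNIV UNIV"
    and dt: "\<And>y s. (\<lambda>t. V y t) differentiable (at s)"
    using V by (auto simp: C1_s_C1_holder_def)
  have hp: "has_partial_y i (\<lambda>z. W z s) y" and c0: "continuous_on UNIV (\<lambda>(y, s). W y s)"
    and c1: "continuous_on UNIV (\<lambda>(y, s). partial_y i (\<lambda>z. W z s) y)"
    if "spatial_C 1 W UNIV UNIV" for W :: "vec3 \<Rightarrow> real \<Rightarrow> vec3" and i y s
    using that unfolding spatial_C_def
    by (auto dest: spec[of _ "[]"] spec[of _ "[i]"])
  have cont: "continuous_on UNIV (v k)" "continuous_on UNIV (w k)" "continuous_on UNIV (d i k)"
     "continuous_on UNIV (dw i k)" "continuous_on UNIV (g e k)" for k i e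
    using c0[OF sC(1)] c0[OF sC(2)] c1[OF sC(1), of i] c1[OF sC(2), of i] Om'_cont
    unfolding v_def w_def d_def dw_def g_def split_beta
    by (auto intro!: continuous_intros)
  have D: "has_dir_deriv (v k) (axis i 1, 0) (d i k)" "has_dir_deriv (w k) (axis i 1, 0) (dw i k)"
    "has_dir_deriv (v k) (0, 1) (w k)" for i k
    unfolding v_def[abs_def] w_def[abs_def] d_def[abs_def] dw_def[abs_def]
    by (intro has_dir_deriv_partial_y has_dir_deriv_partial_s hp sC dt)+
  have "((\<lambda>p. o' k p) has_derivative (\<lambda>h. Om' p h $ k)) (at p)" for k p
    using bounded_linear.has_derivative[OF bounded_linear_vec_nth Om, of k p]
    by (simp add: split_beta o'_def)
  then have Do: "has_dir_deriv (o' k) e (g e k)" for e k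
    using has_dir_deriv_has_derivative[of "o' k" "\<lambda>p h. Om' p h $ k"]
    by (simp add: g_def[abs_def])
  \<comment> \<open>The three components differ by a cyclic permutation. Component k comes from the
    mixed derivatives of Q in the directions i and j.\<close>
  have main: "g (b *\<^sub>R y + V y s, 1) k (y, s) =
     - (a + b) * o' k (y, s) + (\<Sum>m\<in>UNIV. o' m (y, s) * d m k (y, s))"
    if cyc: "(i, j, k) \<in> {(1,2,3), (2,3,1), (3,1,2)}" for i j k :: 3
  proof -
    have sum: "(\<Sum>m\<in>UNIV. f m) = f i + f j + f k" for f :: "3 \<Rightarrow> real"
      using cyc by (auto simp: sum_3)
    have dist: "i \<noteq> j" "j \<noteq> k" "i \<noteq> k" using cyc by auto
    have o': "o' i p = d j k p - d k j p" "o' j p = d k i p - d i k p" "o' k p = d i j p - d j i p" for p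
      using cyc unfolding o'_def d_def by (auto simp: curl_nth)
    have oE: "o' i = (\<lambda>p. d j k p - d k j p)" "o' j = (\<lambda>p. d k i p - d i k p)" "o' k = (\<lambda>p. d i j p - d j i p)"
      using o' by auto
    note Do' = Do[of i, unfolded oE(1)] Do[of j, unfolded oE(2)] Do[of k, unfolded oE(3)]
    have time: "g (0, 1) k p = dw i j p - dw j i p" for p
      by (rule curl_deriv_commute[OF D(1)[of j i] D(1)[of i j] D(3)[of i] D(3)[of j] D(2)[of j i] D(2)[of i j]
            Do'(3)]) (rule cont)+
    have div: "g (axis i 1, 0) i p + g (axis j 1, 0) j p + g (axis k 1, 0) k p = 0" for p
      by (rule div_curl_eq_0[OF D(1)[of i j] D(1)[of i k] D(1)[of j k] D(1)[of j i] D(1)[of k i] D(1)[of k j]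
            cont(1) cont(1) cont(1) cont(3) cont(3) cont(3) cont(3) cont(3) cont(3) Do'
            cont(5) cont(5) cont(5)])
    have trace: "d i i p + d j j p + d k k p = 0" for p
    proof -
      have "div_y (\<lambda>z. V z (snd p)) (fst p) = 0"
        using sol unfolding is_solution_def by blast
      then show ?thesis by (simp only: div_y_def sum d_def)
    qed
    define B where "B m z = b * z $ m + v m (z, s)" for m z
    define Q where "Q = (\<lambda>z. P z s + (V z s \<bullet> V z s) / 2 + b * (z \<bullet> V z s))"
    have Qd: "has_dir_deriv Q (axis m 1)
       (\<lambda>z. - (w m (z, s) + (a - b) * v m (z, s) + (\<Sum>l\<in>UNIV. B l z * (d l m (z, s) - d m l (z, s)))))" for m
      unfolding has_dir_deriv_def
    proof
      fix z
      have P: "((\<lambda>t. P (z + t *\<^sub>R axis m 1) s) has_real_derivative partial_y m (\<lambda>z. P z s) z) (at 0)"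
      proof -
        have "(\<lambda>z. P z s) differentiable at (z + 0 *\<^sub>R axis m 1)"
          using sol by (simp add: is_solution_def)
        then have "(\<lambda>t. P (z + t *\<^sub>R axis m 1) s) differentiable (at 0)"
          by (rule differentiable_compose[where f="\<lambda>z. P z s"]) (auto intro!: derivative_intros)
        then show ?thesis
          by (simp add: partial_y_def vector_derivative_works has_real_derivative_iff_has_vector_derivative)
      qed
      have v: "((\<lambda>t. V (z + t *\<^sub>R axis m 1) s $ l) has_real_derivative d m l (z, s)) (at 0)" for l
        using has_dir_deriv_slice[OF D(1)[of l m], of s] by (simp add: has_dir_deriv_def v_def)
      have Qsum: "Q = (\<lambda>z. P z s + (\<Sum>l\<in>UNIV. (V z s $ l)\<^sup>2) / 2 + b * (\<Sum>l\<in>UNIV. z $ l * V z s $ l))"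
        by (auto simp: Q_def inner_vec_def power2_eq_square)
      have eq: "partial_y m (\<lambda>z. P z s) z = - (w m (z, s) + a * v m (z, s)
          + b * (\<Sum>l\<in>UNIV. z $ l * d l m (z, s)) + (\<Sum>l\<in>UNIV. v l (z, s) * d l m (z, s)))"
      proof -
        have "partial_s V z s + a *\<^sub>R V z s + b *\<^sub>R advect z (\<lambda>z. V z s) z
          + advect (V z s) (\<lambda>z. V z s) z = - grad (\<lambda>z. P z s) z"
          using sol by (simp add: is_solution_def)
        then have "(partial_s V z s + a *\<^sub>R V z s + b *\<^sub>R advect z (\<lambda>z. V z s) z
          + advect (V z s) (\<lambda>z. V z s) z) $ m = - (grad (\<lambda>z. P z s) z $ m)"
          by simp
        then show ?thesis
          by (simp add: advect_def grad_def v_def w_def d_def)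
      qed
      have "((\<lambda>t. Q (z + t *\<^sub>R axis m 1)) has_real_derivative
          partial_y m (\<lambda>z. P z s) z + (\<Sum>l\<in>UNIV. 2 * v l (z, s) * d m l (z, s)) / 2
          + b * (\<Sum>l\<in>UNIV. axis m 1 $ l * v l (z, s) + z $ l * d m l (z, s))) (at 0)"
        unfolding Qsum by (auto intro!: derivative_eq_intros P v simp: v_def algebra_simps)
      moreover have "(\<Sum>l\<in>UNIV. axis m 1 $ l * v l (z, s)) = v m (z, s)"
        by (simp add: axis_def if_distrib[of "\<lambda>x. x * _"] cong: if_cong)
      ultimately show "((\<lambda>t. Q (z + t *\<^sub>R axis m 1)) has_real_derivative
          - (w m (z, s) + (a - b) * v m (z, s) + (\<Sum>l\<in>UNIV. B l z * (d l m (z, s) - d m l (z, s))))) (at 0)"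
        by (simp add: eq B_def sum.distrib sum_subtractf algebra_simps sum_distrib_left sum_divide_distrib)
    qed
    have Qi: "has_dir_deriv Q (axis i 1)
        (\<lambda>z. - (w i (z, s) + (a - b) * v i (z, s) + (B k z * o' j (z, s) - B j z * o' k (z, s))))"
      using Qd[of i] by (simp add: sum o' algebra_simps)
    have Qj: "has_dir_deriv Q (axis j 1)
        (\<lambda>z. - (w j (z, s) + (a - b) * v j (z, s) + (B i z * o' k (z, s) - B k z * o' i (z, s))))"
      using Qd[of j] by (simp add: sum o' algebra_simps)
    have S: "has_dir_deriv (\<lambda>z. v l (z, s)) (axis m 1) (\<lambda>z. d m l (z, s))"
      "has_dir_deriv (\<lambda>z. w l (z, s)) (axis m 1) (\<lambda>z. dw m l (z, s))"
      "has_dir_deriv (\<lambda>z. o' l (z, s)) (axis m 1) (\<lambda>z. g (axis m 1, 0) l (z, s))" for l m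
      by (intro has_dir_deriv_slice D Do)+
    have SB: "has_dir_deriv (B l) (axis m 1) (\<lambda>z. (if l = m then b else 0) + d m l (z, s))" for l m
      using S(1)[of l m] unfolding has_dir_deriv_def B_def
      by (auto intro!: derivative_eq_intros simp: axis_def)
    \<comment> \<open>\<open>ri\<close> and \<open>rj\<close> are the two mixed derivatives of Q;
      their summands b come from differentiating \<open>B\<close>.\<close>
    define ri where "ri z = - (dw j i (z, s) + (a - b) * d j i (z, s) +
       (d j k (z, s) * o' j (z, s) + B k z * g (axis j 1, 0) j (z, s)
        - ((b + d j j (z, s)) * o' k (z, s) + B j z * g (axis j 1, 0) k (z, s))))" for z
    define rj where "rj z = - (dw i j (z, s) + (a - b) * d i j (z, s) +
       ((b + d i i (z, s)) * o' k (z, s) + B i z * g (axis i 1, 0) k (z, s)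
        - (d i k (z, s) * o' i (z, s) + B k z * g (axis i 1, 0) i (z, s))))" for z
    have Ri: "has_dir_deriv (\<lambda>z. - (w i (z, s) + (a - b) * v i (z, s) + (B k z * o' j (z, s) - B j z * o' k (z, s))))
        (axis j 1) ri"
      using S[of i j] S[of j j] S[of k j] SB[of k j] SB[of j j] dist
      unfolding has_dir_deriv_def ri_def
      by (auto intro!: derivative_eq_intros simp: algebra_simps)
    have Rj: "has_dir_deriv (\<lambda>z. - (w j (z, s) + (a - b) * v j (z, s) + (B i z * o' k (z, s) - B k z * o' i (z, s))))
        (axis i 1) rj"
      using S[of j i] S[of i i] S[of k i] SB[of k i] SB[of i i] dist
      unfolding has_dir_deriv_def rj_def
      by (auto intro!: derivative_eq_intros simp: algebra_simps)
    have cs: "continuous_on UNIV (\<lambda>z. f (z, s))" if "continuous_on UNIV f" for f :: "vec3 \<times> real \<Rightarrow> real"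
      by (rule continuous_on_compose2[OF that]) (auto intro!: continuous_intros)
    note cc = cs[OF cont(1)] cs[OF cont(2)] cs[OF cont(3)] cs[OF cont(4)] cs[OF cont(5)]
    have cB: "continuous_on UNIV (B l)" for l
      unfolding B_def by (intro continuous_intros cc)
    have cQ: "continuous_on UNIV Q"
    proof -
      have "continuous_on UNIV (\<lambda>z. P z s)" "continuous_on UNIV (\<lambda>z. V z s)"
        using sol unfolding is_solution_def
        by (auto intro!: differentiable_imp_continuous_on simp: differentiable_on_def)
      then show ?thesis unfolding Q_def by (intro continuous_intros) auto
    qed
    have "ri y = rj y"
      by (rule mixed_derivs_eq[OF Qi Qj Ri Rj cQ])
         (auto simp: ri_def[abs_def] rj_def[abs_def] oE intro!: continuous_intros cc cB)
    moreover have "g (b *\<^sub>R y + V y s, 1) k (y, s) =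
       B i y * g (axis i 1, 0) k (y, s) + B j y * g (axis j 1, 0) k (y, s) + B k y * g (axis k 1, 0) k (y, s)
       + g (0, 1) k (y, s)"
    proof -
      have "b *\<^sub>R y + V y s = (\<Sum>m\<in>UNIV. B m y *\<^sub>R axis m 1)"
        by (simp add: vec_eq_iff B_def v_def axis_def if_distrib cong: if_cong)
      also have "\<dots> = B i y *\<^sub>R axis i 1 + B j y *\<^sub>R axis j 1 + B k y *\<^sub>R axis k 1"
        using cyc by (auto simp: sum_3)
      finally have "(b *\<^sub>R y + V y s, 1::real) = B i y *\<^sub>R (axis i 1, 0) + B j y *\<^sub>R (axis j 1, 0)
         + B k y *\<^sub>R (axis k 1, 0) + (0, 1)" by simp
      then show ?thesis unfolding g_def by (simp only: blinfun.add_right blinfun.scaleR_right) simp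
    qed
    \<comment> \<open>In \<open>ri y = rj y\<close>, \<open>time\<close> supplies the time
      derivative of component k of \<Omega>, the two summands b turn a - b into a + b,
      \<open>div\<close> turns the diagonal derivatives of \<Omega> for i and j into the missing
      transport term, and \<open>trace\<close> turns the diagonal entries of the gradient of V for i
      and j into the one for k.\<close>
    ultimately show ?thesis
      unfolding ri_def rj_def sum
      using time[of "(y, s)"] div[of "(y, s)"] trace[of "(y, s)"] o'(3)[of "(y, s)"]
      by algebra
  qed
  have "Om' (y, s) (b *\<^sub>R y + V y s, 1) $ k = (- (a + b) *\<^sub>R curl (\<lambda>z. V z s) y
     + advect (curl (\<lambda>z. V z s) y) (\<lambda>z. V z s) y) $ k" for k
  proof -
    have "k = 1 \<or> k = 2 \<or> k = 3" using exhaust_3 by blast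
    then have "g (b *\<^sub>R y + V y s, 1) k (y, s) =
     - (a + b) * o' k (y, s) + (\<Sum>m\<in>UNIV. o' m (y, s) * d m k (y, s))"
      using main[of 1 2 3] main[of 2 3 1] main[of 3 1 2] by auto
    then show ?thesis by (simp add: g_def o'_def d_def advect_def)
  qed
  then show ?thesis by (simp add: vec_eq_iff)
qed

section \<open>A weighted maximum principle for time periodic transport equations\<close>

lemma periodic_reduce:
  fixes F :: "'a \<Rightarrow> real \<Rightarrow> 'b"
  assumes "S > 0" and per: "\<And>y s. F y (s + S) = F y s"
  obtains t where "0 \<le> t" "t < S" "\<And>y. F y s = F y t"
proof -
  have nat: "F y (t + real n * S) = F y t" for y t n
  proof (induction n)
    case (Suc n)
    have "t + real (Suc n) * S = (t + real n * S) + S" by (simp add: algebra_simps)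
    then show ?case using per[of y "t + real n * S"] Suc by (simp add: add.assoc)
  qed simp
  have int: "F y (t + of_int m * S) = F y t" for y t m
  proof (cases "m \<ge> 0")
    case True
    then show ?thesis using nat[of y t "nat m"] by simp
  next
    case False
    then show ?thesis using nat[of y "t + of_int m * S" "nat (- m)"] by simp
  qed
  define t where "t = s - of_int \<lfloor>s / S\<rfloor> * S"
  have "of_int \<lfloor>s / S\<rfloor> \<le> s / S" "s / S < of_int \<lfloor>s / S\<rfloor> + 1" by linarith+
  then have "of_int \<lfloor>s / S\<rfloor> * S \<le> s" "s < (of_int \<lfloor>s / S\<rfloor> + 1) * S"
    using \<open>S > 0\<close> by (simp_all only: pos_le_divide_eq pos_divide_less_eq)
  then have "0 \<le> t" "t < S"
    by (simp_all add: t_def algebra_simps)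
  moreover have "F y s = F y t" for y
    using int[of y t "\<lfloor>s / S\<rfloor>"] by (simp add: t_def)
  ultimately show ?thesis using that by blast
qed

text \<open>The weight \<open>|y|\<^sup>-\<^sup>2\<^sup>k\<close> decreases along the outward transport field, which beats the growth
  rate \<open>c\<close>. At a maximum of \<open>|W|\<^sup>2 |y|\<^sup>-\<^sup>2\<^sup>k\<close>, moving against the field (for \<open>\<sigma> = 1\<close>) stays in the ball. At \<open>y = 0\<close> the weight has the junk value \<open>0\<close>.\<close>

lemma transport_vanishing:
  fixes W :: "'a::euclidean_space \<times> real \<Rightarrow> 'b::real_inner" and B :: "'a \<times> real \<Rightarrow> 'a"
  assumes W': "\<And>p. (W has_derivative W' p) (at p)"
    and "S > 0" and per: "\<And>y s. W (y, s + S) = W (y, s)"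
    and eq: "\<And>y s. norm y \<le> R \<Longrightarrow> \<sigma> * (W (y, s) \<bullet> W' (y, s) (B (y, s), 1)) \<le> c * (W (y, s) \<bullet> W (y, s))"
    and out: "\<And>y s. norm y \<le> R \<Longrightarrow> \<theta> * (y \<bullet> y) \<le> \<sigma> * (B (y, s) \<bullet> y)"
    and "\<theta> > 0" "k \<ge> 0" "c < k * \<theta>"
    and small: "\<And>\<epsilon>. \<epsilon> > 0 \<Longrightarrow> \<exists>r>0. \<forall>y s. norm y < r \<longrightarrow> (W (y, s) \<bullet> W (y, s)) * (y \<bullet> y) powr (- k) \<le> \<epsilon>"
    and "norm y \<le> R" "y \<noteq> 0"
  shows "W (y, s) = 0"
proof (rule ccontr)
  assume nz: "W (y, s) \<noteq> 0"
  define f where "f z t = (W (z, t) \<bullet> W (z, t)) * (z \<bullet> z) powr (- k)" for z t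
  define M where "M = f y s"
  have "M > 0" using nz \<open>y \<noteq> 0\<close> by (simp add: M_def f_def)
  have f_per: "f z (t + S) = f z t" for z t by (simp add: f_def per)
  obtain r where "r > 0" and r: "\<And>z t. norm z < r \<Longrightarrow> f z t \<le> M / 2"
    using small[of "M / 2"] \<open>M > 0\<close> unfolding f_def by (meson half_gt_zero)
  \<comment> \<open>On the removed ball f is at most M/2, so no maximum is lost, and on the compact
    remainder the weight is continuous.\<close>
  define K where "K = (cball (0::'a) R - ball 0 r) \<times> {0..S}"
  have contW: "continuous_on UNIV W"
    by (rule has_derivative_continuous_on[where f'=W']) (simp add: W')
  obtain s0 where s0: "0 \<le> s0" "s0 < S" "\<And>z. f z s = f z s0"
    using periodic_reduce[where F=f, OF \<open>S > 0\<close> f_per] by blast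
  have "\<not> norm y < r" using r[of y s] \<open>M > 0\<close> by (auto simp: M_def)
  then have y0K: "(y, s0) \<in> K"
    using \<open>norm y \<le> R\<close> s0 by (auto simp: K_def)
  have "compact K" unfolding K_def by (intro compact_Times compact_diff) auto
  moreover have "continuous_on K (\<lambda>p. f (fst p) (snd p))"
    unfolding f_def using \<open>r > 0\<close>
    by (auto intro!: continuous_intros continuous_on_subset[OF contW] simp: K_def)
  ultimately obtain p where p: "p \<in> K" "\<And>q. q \<in> K \<Longrightarrow> f (fst q) (snd q) \<le> f (fst p) (snd p)"
    using continuous_attains_sup[of K "\<lambda>p. f (fst p) (snd p)"] y0K by blast
  obtain y1 s1 where p_eq: "p = (y1, s1)" by force
  have y1: "norm y1 \<le> R" "r \<le> norm y1" using p(1) by (auto simp: K_def p_eq)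
  have "M \<le> f y1 s1" using p(2)[OF y0K] s0 by (simp add: M_def p_eq)
  then have f1: "f y1 s1 > 0" using \<open>M > 0\<close> by simp
  have max: "f z t \<le> f y1 s1" if z: "norm z \<le> R" for z t
  proof (cases "norm z < r")
    case True
    then show ?thesis using r[of z t] \<open>M > 0\<close> \<open>M \<le> f y1 s1\<close> by linarith
  next
    case False
    obtain t' where "0 \<le> t'" "t' < S" "\<And>z. f z t = f z t'"
      using periodic_reduce[where F=f, OF \<open>S > 0\<close> f_per] by blast
    then show ?thesis using p(2)[of "(z, t')"] z False by (simp add: K_def p_eq)
  qed
  define B1 where "B1 = \<sigma> *\<^sub>R B (y1, s1)"
  define u where "u \<tau> = (y1 - \<tau> *\<^sub>R B1) \<bullet> (y1 - \<tau> *\<^sub>R B1)" for \<tau>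
  \<comment> \<open>A straight line through the maximum point, run against the field; \<sigma> = -1
    reverses time together with the field.\<close>
  define \<phi> where "\<phi> \<tau> = f (y1 - \<tau> *\<^sub>R B1) (s1 - \<tau> * \<sigma>)" for \<tau>
  have y1_pos: "y1 \<bullet> y1 > 0" using y1 \<open>r > 0\<close> by auto
  let ?W = "W (y1, s1)" and ?D = "W' (y1, s1) (B (y1, s1), 1)"
  have du: "(u has_real_derivative - 2 * (B1 \<bullet> y1)) (at 0)"
  proof -
    have "u = (\<lambda>\<tau>. y1 \<bullet> y1 - 2 * \<tau> * (B1 \<bullet> y1) + \<tau>\<^sup>2 * (B1 \<bullet> B1))"
      by (auto simp: u_def algebra_simps inner_commute power2_eq_square)
    then show ?thesis by (auto intro!: derivative_eq_intros)
  qed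
  have dW: "((\<lambda>\<tau>. W (y1 - \<tau> *\<^sub>R B1, s1 - \<tau> * \<sigma>)) has_vector_derivative - \<sigma> *\<^sub>R ?D) (at 0)"
  proof -
    have "((\<lambda>\<tau>. (y1 - \<tau> *\<^sub>R B1, s1 - \<tau> * \<sigma>)) has_derivative (\<lambda>\<tau>. (- \<tau> *\<^sub>R B1, - \<tau> * \<sigma>))) (at 0)"
      by (auto intro!: derivative_eq_intros)
    from has_derivative_compose[OF this, of W "W' (y1, s1)"]
    have "((\<lambda>\<tau>. W (y1 - \<tau> *\<^sub>R B1, s1 - \<tau> * \<sigma>)) has_derivative
        (\<lambda>\<tau>. W' (y1, s1) (- \<tau> *\<^sub>R B1, - \<tau> * \<sigma>))) (at 0)"
      using W' by simp
    moreover have "W' (y1, s1) (- \<tau> *\<^sub>R B1, - \<tau> * \<sigma>) = \<tau> *\<^sub>R (- \<sigma> *\<^sub>R ?D)" for \<tau>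
      using linear_scale[OF has_derivative_linear[OF W'[of "(y1, s1)"]], of "- \<tau> * \<sigma>" "(B (y1, s1), 1)"]
      by (simp add: B1_def)
    ultimately show ?thesis by (simp add: has_vector_derivative_def)
  qed
  have dWW: "((\<lambda>\<tau>. W (y1 - \<tau> *\<^sub>R B1, s1 - \<tau> * \<sigma>) \<bullet> W (y1 - \<tau> *\<^sub>R B1, s1 - \<tau> * \<sigma>))
      has_real_derivative - 2 * \<sigma> * (?W \<bullet> ?D)) (at 0)"
    using has_derivative_inner[OF dW[unfolded has_vector_derivative_def] dW[unfolded has_vector_derivative_def]]
    unfolding has_field_derivative_def
    by (rule has_derivative_eq_rhs) (auto simp: inner_commute algebra_simps)
  have dpow: "((\<lambda>\<tau>. u \<tau> powr (- k)) has_real_derivative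
      - k * (y1 \<bullet> y1) powr (- k - 1) * (- 2 * (B1 \<bullet> y1))) (at 0)"
    using DERIV_fun_powr[OF du, of "- k"] y1_pos by (simp add: u_def)
  have pw: "(y1 \<bullet> y1) powr (- k - 1) * (y1 \<bullet> y1) = (y1 \<bullet> y1) powr (- k)"
    using y1_pos by (simp add: powr_diff)
  have "(\<phi> has_real_derivative
      (- 2 * \<sigma> * (?W \<bullet> ?D)) * (y1 \<bullet> y1) powr (- k) +
      (?W \<bullet> ?W) * (- k * (y1 \<bullet> y1) powr (- k - 1) * (- 2 * (B1 \<bullet> y1)))) (at 0)" (is "(_ has_real_derivative ?d) _")
    using DERIV_mult'[OF dWW dpow] unfolding \<phi>_def f_def u_def by (simp add: algebra_simps)
  \<comment> \<open>Relative to |W|^2 |y|^(-2k), growth costs at most 2c and the weight gains at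
    least 2k\<theta>, so the derivative is at least 2(k\<theta> - c) times a positive value.\<close>
  moreover have "?d > 0"
  proof -
    have WW: "?W \<bullet> ?W > 0" using f1 by (auto simp: f_def)
    have 1: "\<sigma> * (?W \<bullet> ?D) * (y1 \<bullet> y1) powr (- k) \<le> c * (?W \<bullet> ?W) * (y1 \<bullet> y1) powr (- k)"
      by (intro mult_right_mono eq y1) auto
    have 2: "k * (?W \<bullet> ?W) * (y1 \<bullet> y1) powr (- k - 1) * (\<theta> * (y1 \<bullet> y1)) \<le>
        k * (?W \<bullet> ?W) * (y1 \<bullet> y1) powr (- k - 1) * (B1 \<bullet> y1)"
      using out[OF y1(1), of s1] \<open>k \<ge> 0\<close> by (intro mult_left_mono) (auto simp: B1_def)
    have 3: "c * ((?W \<bullet> ?W) * (y1 \<bullet> y1) powr (- k)) < k * \<theta> * ((?W \<bullet> ?W) * (y1 \<bullet> y1) powr (- k))"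
      using WW y1_pos \<open>c < k * \<theta>\<close> by (intro mult_strict_right_mono) auto
    have "k * (?W \<bullet> ?W) * (y1 \<bullet> y1) powr (- k - 1) * (\<theta> * (y1 \<bullet> y1)) =
        k * \<theta> * ((?W \<bullet> ?W) * (y1 \<bullet> y1) powr (- k))"
      by (simp add: pw[symmetric])
    with 2 have "k * \<theta> * ((?W \<bullet> ?W) * (y1 \<bullet> y1) powr (- k)) \<le>
        k * (?W \<bullet> ?W) * (y1 \<bullet> y1) powr (- k - 1) * (B1 \<bullet> y1)"
      by (simp only:)
    then show ?thesis using 1 3 by (simp add: algebra_simps)
  qed
  ultimately obtain e where "e > 0" and inc: "\<And>h. 0 < h \<Longrightarrow> h < e \<Longrightarrow> \<phi> 0 < \<phi> (0 + h)"
    using DERIV_pos_inc_right by blast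
  \<comment> \<open>The maximum may lie on the sphere |y| = R, so the step must not leave the ball:
    |y1 - h B1|^2 \<le> |y1|^2 holds once h |B1|^2 \<le> 2 (B1 . y1), and \<open>out\<close> bounds
    the right side below by 2\<theta>|y1|^2. The 1 keeps the denominator positive.\<close>
  define h where "h = min (e / 2) (2 * \<theta> * (y1 \<bullet> y1) / (1 + B1 \<bullet> B1))"
  have h: "0 < h" "h < e" using \<open>e > 0\<close> \<open>\<theta> > 0\<close> y1_pos
    by (auto simp: h_def add_pos_nonneg min_less_iff_disj)
  have "h * (B1 \<bullet> B1) \<le> h * (1 + B1 \<bullet> B1)" using h by simp
  also have "h * (1 + B1 \<bullet> B1) \<le> 2 * \<theta> * (y1 \<bullet> y1)"
  proof -
    have "1 + B1 \<bullet> B1 > 0" by (simp add: add_pos_nonneg)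
    moreover have "h \<le> 2 * \<theta> * (y1 \<bullet> y1) / (1 + B1 \<bullet> B1)" by (simp add: h_def)
    ultimately show ?thesis by (simp add: pos_le_divide_eq)
  qed
  also have "\<dots> \<le> 2 * (B1 \<bullet> y1)" using out[OF y1(1), of s1] by (simp add: B1_def)
  finally have "h * (h * (B1 \<bullet> B1)) \<le> h * (2 * (B1 \<bullet> y1))"
    using h by (intro mult_left_mono) auto
  then have "(y1 - h *\<^sub>R B1) \<bullet> (y1 - h *\<^sub>R B1) \<le> y1 \<bullet> y1"
    by (simp add: algebra_simps inner_commute)
  then have "norm (y1 - h *\<^sub>R B1) \<le> R"
    using y1(1) norm_le[of "y1 - h *\<^sub>R B1" y1] by linarith
  from max[OF this, of "s1 - h * \<sigma>"] inc[OF h] show False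
    by (simp add: \<phi>_def)
qed

section \<open>Fields without divergence and curl\<close>

text \<open>The integral of a compactly supported function does not change under translation;
  differentiate it in the shift under the integral sign. The margin \<open>norm e\<close> keeps the
  support in the box for all shifts by \<open>t *\<^sub>R e\<close> with |t| \<le> 1.\<close>

lemma integral_deriv_compact_support:
  fixes g :: "'a::euclidean_space \<Rightarrow> real"
  assumes g': "\<And>x. (g has_derivative g' x) (at x)"
    and cont: "continuous_on UNIV (\<lambda>x. g' x e)"
    and supp: "\<And>x. norm x \<ge> \<rho> \<Longrightarrow> g x = 0"
    and box: "cball 0 (\<rho> + norm e) \<subseteq> cbox a b"
  shows "integral (cbox a b) (\<lambda>x. g' x e) = 0"
proof -
  have cg: "continuous_on UNIV g"
    by (rule has_derivative_continuous_on[where f'=g']) (simp add: g')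
  have const: "integral (cbox a b) (\<lambda>x. g (x + t *\<^sub>R e)) = integral (cball 0 \<rho>) g" if "t \<in> {-1..1}" for t
  proof -
    have sub: "cball 0 \<rho> \<subseteq> cbox (a + t *\<^sub>R e) (b + t *\<^sub>R e)"
    proof
      fix x :: 'a assume x: "x \<in> cball 0 \<rho>"
      have "norm (x - t *\<^sub>R e) \<le> norm x + \<bar>t\<bar> * norm e"
        using norm_triangle_ineq4[of x "t *\<^sub>R e"] by simp
      also have "\<dots> \<le> \<rho> + 1 * norm e"
        using x that by (intro add_mono mult_right_mono) auto
      finally have "x - t *\<^sub>R e \<in> cbox a b" using box by auto
      then show "x \<in> cbox (a + t *\<^sub>R e) (b + t *\<^sub>R e)"
        by (auto simp: mem_box algebra_simps)
    qed
    have "integral (cbox a b) (\<lambda>x. g (x + t *\<^sub>R e)) = integral (cbox (a + t *\<^sub>R e) (b + t *\<^sub>R e)) g"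
      using integral_shift_cbox_plus[of a b g "t *\<^sub>R e"] by (simp add: o_def add.commute)
    also have "\<dots> = integral (cbox (a + t *\<^sub>R e) (b + t *\<^sub>R e)) (\<lambda>x. if x \<in> cball 0 \<rho> then g x else 0)"
      by (rule integral_cong) (auto simp: supp)
    also have "\<dots> = integral (cball 0 \<rho>) g"
      by (simp only: Henstock_Kurzweil_Integration.integral_restrict_Int inf_absorb1[OF sub])
    finally show ?thesis .
  qed
  have "((\<lambda>t. integral (cbox a b) (\<lambda>x. g (x + t *\<^sub>R e))) has_field_derivative
      integral (cbox a b) (\<lambda>x. g' (x + 0 *\<^sub>R e) e)) (at 0 within {-1..1})"
  proof (rule leibniz_rule_field_derivative)
    fix t x
    have "((\<lambda>t. x + t *\<^sub>R e) has_derivative (\<lambda>t. t *\<^sub>R e)) (at t within {-1..1})"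
      by (auto intro!: derivative_eq_intros)
    from has_derivative_compose[OF this g'[of "x + t *\<^sub>R e"]]
    have "((\<lambda>t. g (x + t *\<^sub>R e)) has_derivative (\<lambda>u. g' (x + t *\<^sub>R e) (u *\<^sub>R e))) (at t within {-1..1})" .
    moreover have "(\<lambda>u. g' (x + t *\<^sub>R e) (u *\<^sub>R e)) = (*) (g' (x + t *\<^sub>R e) e)"
      using linear_scale[OF has_derivative_linear[OF g']] by (auto simp: mult.commute)
    ultimately show "((\<lambda>t. g (x + t *\<^sub>R e)) has_field_derivative g' (x + t *\<^sub>R e) e) (at t within {-1..1})"
      by (simp add: has_field_derivative_def)
  next
    show "(\<lambda>x. g (x + t *\<^sub>R e)) integrable_on cbox a b" for t
      by (rule integrable_continuous, rule continuous_on_compose2[OF cg]) (auto intro!: continuous_intros)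
    show "continuous_on ({-1..1} \<times> cbox a b) (\<lambda>(t, x). g' (x + t *\<^sub>R e) e)"
      unfolding split_beta by (rule continuous_on_compose2[OF cont]) (auto intro!: continuous_intros)
  qed auto
  then have "((\<lambda>t. integral (cbox a b) (\<lambda>x. g (x + t *\<^sub>R e))) has_vector_derivative
      integral (cbox a b) (\<lambda>x. g' x e)) (at 0 within cbox (-1) 1)"
    by (simp add: has_real_derivative_iff_has_vector_derivative)
  moreover have "((\<lambda>t. integral (cbox a b) (\<lambda>x. g (x + t *\<^sub>R e))) has_vector_derivative 0) (at 0 within cbox (-1) 1)"
    by (rule has_vector_derivative_transform[where f="\<lambda>_. integral (cball 0 \<rho>) g"])
       (use const in simp_all)
  ultimately show ?thesis
    by (rule vector_derivative_unique_within_closed_interval[rotated 2]) simp_all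
qed

text \<open>Gradients of harmonic functions on a ball, described in first order and in any
  dimension: symmetry of the derivative stands for zero curl, zero trace for zero divergence.
  Differentiability is global so that integrals over boxes need no localization; only the two
  equations are confined to the ball.\<close>

definition div_curl_free :: "real \<Rightarrow> ('a::euclidean_space \<Rightarrow> 'a) \<Rightarrow> ('a \<Rightarrow> 'a \<Rightarrow> 'a) \<Rightarrow> bool" where
  "div_curl_free r U U' \<longleftrightarrow>
     (\<forall>x. (U has_derivative U' x) (at x)) \<and> (\<forall>h. continuous_on UNIV (\<lambda>x. U' x h)) \<and>
     (\<forall>x h k. norm x < r \<longrightarrow> U' x h \<bullet> k = U' x k \<bullet> h) \<and>
     (\<forall>x. norm x < r \<longrightarrow> (\<Sum>i\<in>Basis. U' x i \<bullet> i) = 0)"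

lemma div_curl_free_continuous:
  assumes "div_curl_free r U U'"
  shows "continuous_on UNIV U"
  by (rule has_derivative_continuous_on[where f'=U']) (use assms in \<open>simp add: div_curl_free_def\<close>)

text \<open>The square makes the weight continuously differentiable across the sphere of radius
  \<rho>, and radial symmetry makes its gradient parallel to x.\<close>

definition bump :: "real \<Rightarrow> 'a::real_inner \<Rightarrow> real" where
  "bump \<rho> x = (max 0 (\<rho>\<^sup>2 - x \<bullet> x))\<^sup>2"

lemma bump_eq_0: "0 \<le> \<rho> \<Longrightarrow> \<rho> \<le> norm x \<Longrightarrow> bump \<rho> x = 0"
  using power_mono[of \<rho> "norm x" 2] by (simp add: bump_def power2_norm_eq_inner)

lemma bump_pos: "norm x < \<rho> \<Longrightarrow> 0 < bump \<rho> x"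
  using power_strict_mono[of "norm x" \<rho> 2] by (simp add: bump_def power2_norm_eq_inner)

lemma bump_nonneg: "0 \<le> bump \<rho> x"
  by (simp add: bump_def)

lemma continuous_on_bump: "continuous_on S (bump \<rho>)"
  unfolding bump_def[abs_def] by (intro continuous_intros)

lemma max_0_square_has_derivative: "((\<lambda>x::real. (max 0 x)\<^sup>2) has_real_derivative 2 * max 0 x) (at x)"
proof (cases "x = 0")
  case True
  have "((\<lambda>h. (max 0 h)\<^sup>2 / h) \<longlongrightarrow> 0) (at (0::real))"
  proof (rule Lim_null_comparison)
    show "\<forall>\<^sub>F h in at (0::real). norm ((max 0 h)\<^sup>2 / h) \<le> \<bar>h\<bar>"
      by (rule always_eventually) (auto simp: max_def power2_eq_square)
    show "((\<lambda>h. \<bar>h\<bar>) \<longlongrightarrow> 0) (at (0::real))"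
      by (intro tendsto_eq_intros) auto
  qed
  then show ?thesis using True by (simp add: DERIV_def)
next
  case False
  show ?thesis
  proof (cases "x > 0")
    case True
    have "((\<lambda>x::real. x\<^sup>2) has_real_derivative 2 * max 0 x) (at x)"
      using True by (auto intro!: derivative_eq_intros)
    then show ?thesis
      by (rule has_field_derivative_transform_within_open[where S="{0<..}"]) (use True in auto)
  next
    case F: False
    have "((\<lambda>x::real. 0) has_real_derivative 2 * max 0 x) (at x)"
      using F by auto
    then show ?thesis
      by (rule has_field_derivative_transform_within_open[where S="{..<0}"]) (use F False in auto)
  qed
qed

lemma bump_has_derivative:
  "(bump \<rho> has_derivative (\<lambda>h. - 4 * max 0 (\<rho>\<^sup>2 - x \<bullet> x) * (x \<bullet> h))) (at x)"
proof -
  have "((\<lambda>x. \<rho>\<^sup>2 - x \<bullet> x) has_derivative (\<lambda>h. - 2 * (x \<bullet> h))) (at x)"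
    by (auto intro!: derivative_eq_intros simp: inner_commute)
  from has_derivative_compose[OF this max_0_square_has_derivative[unfolded has_field_derivative_def]]
  show ?thesis by (simp add: bump_def[abs_def] algebra_simps)
qed

text \<open>The vector field \<open>bump ((x \<bullet> U) W - (x \<bullet> W) U)\<close> has the integrand as its divergence.\<close>

lemma div_curl_free_green:
  fixes U W :: "'a::euclidean_space \<Rightarrow> 'a"
  assumes U: "div_curl_free \<rho> U U'" and W: "div_curl_free \<rho> W W'" and "\<rho> \<ge> 0"
    and box: "cball 0 (\<rho> + 1) \<subseteq> cbox a b"
  shows "integral (cbox a b) (\<lambda>x. bump \<rho> x * (U' x x \<bullet> W x - U x \<bullet> W' x x)) = 0"
proof -
  note dU = U[unfolded div_curl_free_def] and dW = W[unfolded div_curl_free_def]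
  have cU: "continuous_on UNIV U" and cW: "continuous_on UNIV W"
    by (rule div_curl_free_continuous[OF U] div_curl_free_continuous[OF W])+
  define g where "g i x = bump \<rho> x * ((x \<bullet> U x) * (W x \<bullet> i) - (x \<bullet> W x) * (U x \<bullet> i))" for i x
  define g' where "g' i x h = - 4 * max 0 (\<rho>\<^sup>2 - x \<bullet> x) * (x \<bullet> h) * ((x \<bullet> U x) * (W x \<bullet> i) - (x \<bullet> W x) * (U x \<bullet> i))
      + bump \<rho> x * ((h \<bullet> U x + x \<bullet> U' x h) * (W x \<bullet> i) + (x \<bullet> U x) * (W' x h \<bullet> i)
          - (h \<bullet> W x + x \<bullet> W' x h) * (U x \<bullet> i) - (x \<bullet> W x) * (U' x h \<bullet> i))" for i x h
  have g: "(g i has_derivative g' i x) (at x)" for i x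
  proof -
    have 1: "(U has_derivative U' x) (at x)" "(W has_derivative W' x) (at x)"
      using dU dW by auto
    show ?thesis unfolding g_def[abs_def] g'_def[abs_def]
      by (rule derivative_eq_intros bump_has_derivative 1 refl | simp)+
         (auto simp: algebra_simps fun_eq_iff)
  qed
  have cg: "continuous_on UNIV (\<lambda>x. g' i x h)" for i h
    unfolding g'_def using dU dW
    by (intro continuous_intros continuous_on_bump cU cW) auto
  have int0: "integral (cbox a b) (\<lambda>x. g' i x i) = 0" if "i \<in> Basis" for i
    by (rule integral_deriv_compact_support[OF g cg, of \<rho>])
       (use box that \<open>\<rho> \<ge> 0\<close> in \<open>auto simp: g_def bump_eq_0\<close>)
  have eq: "(\<Sum>i\<in>Basis. g' i x i) = bump \<rho> x * (U' x x \<bullet> W x - U x \<bullet> W' x x)" for x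
  proof (cases "norm x < \<rho>")
    case False
    then have "bump \<rho> x = 0" using \<open>\<rho> \<ge> 0\<close> by (intro bump_eq_0) auto
    moreover from this have "max 0 (\<rho>\<^sup>2 - x \<bullet> x) = 0" by (simp add: bump_def)
    ultimately show ?thesis by (simp add: g'_def)
  next
    case True
    have sU: "x \<bullet> U' x i = U' x x \<bullet> i" and sW: "x \<bullet> W' x i = W' x x \<bullet> i" for i
      using dU dW True by (auto simp: inner_commute)
    have tr: "(\<Sum>i\<in>Basis. U' x i \<bullet> i) = 0" "(\<Sum>i\<in>Basis. W' x i \<bullet> i) = 0"
      using dU dW True by auto
    have "g' i x i = - 4 * max 0 (\<rho>\<^sup>2 - x \<bullet> x) * ((x \<bullet> U x) * ((x \<bullet> i) * (W x \<bullet> i)) - (x \<bullet> W x) * ((x \<bullet> i) * (U x \<bullet> i)))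
      + bump \<rho> x * ((U' x x \<bullet> i) * (W x \<bullet> i) + (x \<bullet> U x) * (W' x i \<bullet> i)
          - (W' x x \<bullet> i) * (U x \<bullet> i) - (x \<bullet> W x) * (U' x i \<bullet> i))" for i
      by (simp add: g'_def sU sW inner_commute[of i] algebra_simps)
    then have "(\<Sum>i\<in>Basis. g' i x i) = - 4 * max 0 (\<rho>\<^sup>2 - x \<bullet> x) *
        ((x \<bullet> U x) * (\<Sum>i\<in>Basis. (x \<bullet> i) * (W x \<bullet> i)) - (x \<bullet> W x) * (\<Sum>i\<in>Basis. (x \<bullet> i) * (U x \<bullet> i)))
      + bump \<rho> x * ((\<Sum>i\<in>Basis. (U' x x \<bullet> i) * (W x \<bullet> i)) + (x \<bullet> U x) * (\<Sum>i\<in>Basis. W' x i \<bullet> i)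
          - (\<Sum>i\<in>Basis. (W' x x \<bullet> i) * (U x \<bullet> i)) - (x \<bullet> W x) * (\<Sum>i\<in>Basis. U' x i \<bullet> i))"
      by (simp only: sum.distrib sum_subtractf sum_distrib_left[symmetric])
    \<comment> \<open>The gradient of the weight contributes a multiple of (x . U)(x . W) - (x .
      W)(x . U), which is 0.\<close>
    then show ?thesis
      unfolding tr euclidean_inner[symmetric]
      by (simp add: inner_commute[of "W' x x"] mult.commute)
  qed
  have "integral (cbox a b) (\<lambda>x. \<Sum>i\<in>Basis. g' i x i) = (\<Sum>i\<in>Basis. integral (cbox a b) (\<lambda>x. g' i x i))"
    by (intro integral_sum integrable_continuous continuous_on_subset[OF cg]) auto
  then show ?thesis using int0 by (simp add: eq)
qed

section \<open>Dilations and the pairing of two fields\<close>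

lemma div_curl_free_scale:
  assumes "div_curl_free r U U'" "c > 0"
  shows "div_curl_free (r / c) (\<lambda>x. U (c *\<^sub>R x)) (\<lambda>x h. c *\<^sub>R U' (c *\<^sub>R x) h)"
  unfolding div_curl_free_def
proof (intro conjI allI impI)
  note dU = assms(1)[unfolded div_curl_free_def]
  show "((\<lambda>x. U (c *\<^sub>R x)) has_derivative (\<lambda>h. c *\<^sub>R U' (c *\<^sub>R x) h)) (at x)" for x
  proof -
    have "((\<lambda>x. c *\<^sub>R x) has_derivative (\<lambda>h. c *\<^sub>R h)) (at x)"
      by (auto intro!: derivative_eq_intros)
    from has_derivative_compose[OF this, of U "U' (c *\<^sub>R x)"] dU
    have "((\<lambda>x. U (c *\<^sub>R x)) has_derivative (\<lambda>h. U' (c *\<^sub>R x) (c *\<^sub>R h))) (at x)"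
      by auto
    moreover have "linear (U' (c *\<^sub>R x))"
      using dU has_derivative_linear by blast
    ultimately show ?thesis by (simp add: linear_scale)
  qed
  show "continuous_on UNIV (\<lambda>x. c *\<^sub>R U' (c *\<^sub>R x) h)" for h
    by (intro continuous_intros continuous_on_compose2[of UNIV "\<lambda>x. U' x h" UNIV "\<lambda>x. c *\<^sub>R x"])
       (use dU in auto)
  fix x :: 'a assume "norm x < r / c"
  then have x: "norm (c *\<^sub>R x) < r" using \<open>c > 0\<close> by (simp add: field_simps)
  show "c *\<^sub>R U' (c *\<^sub>R x) h \<bullet> k = c *\<^sub>R U' (c *\<^sub>R x) k \<bullet> h" for h k
  proof -
    have "U' (c *\<^sub>R x) h \<bullet> k = U' (c *\<^sub>R x) k \<bullet> h" using dU x by blast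
    then show ?thesis by simp
  qed
  have "(\<Sum>i\<in>Basis. U' (c *\<^sub>R x) i \<bullet> i) = 0" using dU x by blast
  then show "(\<Sum>i\<in>Basis. c *\<^sub>R U' (c *\<^sub>R x) i \<bullet> i) = 0"
    by (simp add: sum_distrib_left[symmetric])
qed

lemma div_curl_free_mono: "div_curl_free r U U' \<Longrightarrow> s \<le> r \<Longrightarrow> div_curl_free s U U'"
  unfolding div_curl_free_def by (meson less_le_trans)

text \<open>Continuity for each fixed direction gives joint continuity, by expanding the direction
  in a finite basis.\<close>

lemma continuous_on_deriv_apply:
  fixes F :: "'a::euclidean_space \<Rightarrow> 'b::real_normed_vector"
  assumes F': "\<And>x. (F has_derivative F' x) (at x)" "\<And>h. continuous_on UNIV (\<lambda>x. F' x h)"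
    and fh: "continuous_on S f" "continuous_on S h"
  shows "continuous_on S (\<lambda>x. F' (f x) (h x))"
proof -
  have "F' (f x) (h x) = (\<Sum>i\<in>Basis. (h x \<bullet> i) *\<^sub>R F' (f x) i)" for x
  proof -
    have "linear (F' (f x))" using F'(1) has_derivative_linear by blast
    then have "F' (f x) (\<Sum>i\<in>Basis. (h x \<bullet> i) *\<^sub>R i) = (\<Sum>i\<in>Basis. (h x \<bullet> i) *\<^sub>R F' (f x) i)"
      by (simp add: linear_sum linear_scale)
    then show ?thesis by (simp add: euclidean_representation)
  qed
  then show ?thesis
    by (auto intro!: continuous_intros fh continuous_on_compose2[OF F'(2) fh(1)])
qed

text \<open>The reason behind this identity: homogeneous harmonic fields of distinct degrees are orthogonal on
  spheres, and for equal degrees the powers of \<open>exp T\<close> cancel. With constant \<open>W\<close> it is a mean value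
  property, with \<open>W = U\<close> it propagates zeros of \<open>U\<close> outwards.\<close>

lemma div_curl_free_pairing_const:
  fixes U W :: "'a::euclidean_space \<Rightarrow> 'a"
  assumes U: "div_curl_free r U U'" and W: "div_curl_free q W W'" and "\<rho> \<ge> 0" "T \<ge> 0"
    and r: "\<rho> \<le> r" and q: "\<rho> * exp T \<le> q"
    and box: "cball 0 (\<rho> + 1) \<subseteq> cbox a b"
  shows "integral (cbox a b) (\<lambda>x. bump \<rho> x * (U (exp (- T) *\<^sub>R x) \<bullet> W (exp T *\<^sub>R x))) =
    integral (cbox a b) (\<lambda>x. bump \<rho> x * (U x \<bullet> W x))"
proof -
  define E where "E t = integral (cbox a b) (\<lambda>x. bump \<rho> x * (U (exp (- t) *\<^sub>R x) \<bullet> W (exp t *\<^sub>R x)))" for t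
  note dU = U[unfolded div_curl_free_def] and dW = W[unfolded div_curl_free_def]
  have cU: "continuous_on UNIV U" and cW: "continuous_on UNIV W"
    by (rule div_curl_free_continuous[OF U] div_curl_free_continuous[OF W])+
  have deriv: "(E has_field_derivative 0) (at t within {0..T})" if t: "t \<in> {0..T}" for t
  proof -
    let ?d = "\<lambda>t x. bump \<rho> x * (U (exp (- t) *\<^sub>R x) \<bullet> (exp t *\<^sub>R W' (exp t *\<^sub>R x) x)
        - (exp (- t) *\<^sub>R U' (exp (- t) *\<^sub>R x) x) \<bullet> W (exp t *\<^sub>R x))"
    have "(E has_field_derivative integral (cbox a b) (?d t)) (at t within {0..T})"
      unfolding E_def
    proof (rule leibniz_rule_field_derivative)
      fix t :: real and x :: 'a
      have e: "((\<lambda>t. exp (c * t) *\<^sub>R x) has_derivative (\<lambda>h. h *\<^sub>R ((c * exp (c * t)) *\<^sub>R x))) (at t within {0..T})" for c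
        by (auto intro!: derivative_eq_intros simp: algebra_simps)
      have F: "((\<lambda>t. F (exp (c * t) *\<^sub>R x)) has_derivative (\<lambda>h. h *\<^sub>R ((c * exp (c * t)) *\<^sub>R F' (exp (c * t) *\<^sub>R x) x)))
          (at t within {0..T})" if F': "\<And>x. (F has_derivative F' x) (at x)" for F :: "'a \<Rightarrow> 'a" and F' c
        using has_derivative_compose[OF e F'] linear_scale[OF has_derivative_linear[OF F']] by simp
      have FU: "((\<lambda>t. U (exp (- t) *\<^sub>R x)) has_derivative (\<lambda>h. h *\<^sub>R (- (exp (- t) *\<^sub>R U' (exp (- t) *\<^sub>R x) x)))) (at t within {0..T})"
        using F[of U U' "-1"] dU by simp
      have FW: "((\<lambda>t. W (exp t *\<^sub>R x)) has_derivative (\<lambda>h. h *\<^sub>R (exp t *\<^sub>R W' (exp t *\<^sub>R x) x))) (at t within {0..T})"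
        using F[of W W' 1] dW by simp
      show "((\<lambda>t. bump \<rho> x * (U (exp (- t) *\<^sub>R x) \<bullet> W (exp t *\<^sub>R x))) has_field_derivative ?d t x) (at t within {0..T})"
        unfolding has_field_derivative_def
        by (rule has_derivative_eq_rhs[OF has_derivative_mult_right[OF has_derivative_inner[OF FU FW]]])
           (auto simp: algebra_simps)
    next
      show "(\<lambda>x. bump \<rho> x * (U (exp (- t) *\<^sub>R x) \<bullet> W (exp t *\<^sub>R x))) integrable_on cbox a b" for t
        by (intro integrable_continuous continuous_intros continuous_on_bump
            continuous_on_compose2[OF cU] continuous_on_compose2[OF cW]) auto
      have "continuous_on ({0..T} \<times> cbox a b) (\<lambda>p. U (exp (- fst p) *\<^sub>R snd p))"
        "continuous_on ({0..T} \<times> cbox a b) (\<lambda>p. W (exp (fst p) *\<^sub>R snd p))"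
        by (rule continuous_on_compose2[OF cU] continuous_on_compose2[OF cW], intro continuous_intros, simp)+
      moreover have "continuous_on ({0..T} \<times> cbox a b) (\<lambda>p. U' (exp (- fst p) *\<^sub>R snd p) (snd p))"
        "continuous_on ({0..T} \<times> cbox a b) (\<lambda>p. W' (exp (fst p) *\<^sub>R snd p) (snd p))"
        using dU dW
        by (auto intro!: continuous_intros
              continuous_on_deriv_apply[where F=U and F'=U' and f="\<lambda>p. exp (- fst p) *\<^sub>R snd p" and h=snd]
              continuous_on_deriv_apply[where F=W and F'=W' and f="\<lambda>p. exp (fst p) *\<^sub>R snd p" and h=snd])
      moreover have "continuous_on ({0..T} \<times> cbox a b) (\<lambda>p. bump \<rho> (snd p))"
        by (rule continuous_on_compose2[OF continuous_on_bump[of UNIV]]) (auto intro!: continuous_intros)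
      ultimately show "continuous_on ({0..T} \<times> cbox a b) (\<lambda>(t, x). ?d t x)"
        unfolding split_beta by (intro continuous_intros)
    qed (use t in auto)
    \<comment> \<open>Green's identity for the dilated fields. Both are free of divergence and curl
      on the ball of radius \<rho>: dilation by exp(-t) enlarges the good ball of U, and q is large
      enough to survive dilation by exp t.\<close>
    moreover have "integral (cbox a b) (?d t) = 0"
    proof -
      have "\<rho> \<le> r / exp (- t)"
      proof -
        have "\<rho> * exp (- t) \<le> \<rho> * 1" using t \<open>\<rho> \<ge> 0\<close> by (intro mult_left_mono) auto
        then show ?thesis using r by (simp add: pos_le_divide_eq)
      qed
      moreover have "\<rho> \<le> q / exp t"
      proof -
        have "\<rho> * exp t \<le> \<rho> * exp T" using t \<open>\<rho> \<ge> 0\<close> by (intro mult_left_mono) auto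
        then show ?thesis using q by (simp add: pos_le_divide_eq)
      qed
      ultimately have "integral (cbox a b) (\<lambda>x. bump \<rho> x *
          ((exp t *\<^sub>R W' (exp t *\<^sub>R x) x) \<bullet> U (exp (- t) *\<^sub>R x) - W (exp t *\<^sub>R x) \<bullet> (exp (- t) *\<^sub>R U' (exp (- t) *\<^sub>R x) x))) = 0"
        by (intro div_curl_free_green[OF _ _ \<open>\<rho> \<ge> 0\<close> box]
            div_curl_free_mono[OF div_curl_free_scale[OF U]] div_curl_free_mono[OF div_curl_free_scale[OF W]]) auto
      then show ?thesis by (simp only: inner_commute[of "W _"] inner_commute[of "_ *\<^sub>R W' _ _"])
    qed
    ultimately show ?thesis by simp
  qed
  obtain c where "\<And>t. t \<in> {0..T} \<Longrightarrow> E t = c"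
    using has_field_derivative_zero_constant[OF _ deriv] by auto
  then have "E T = E 0" using \<open>T \<ge> 0\<close> by simp
  then show ?thesis by (simp add: E_def)
qed

lemma integral_bump_eq_0D:
  fixes f :: "'a::euclidean_space \<Rightarrow> real"
  assumes f: "continuous_on UNIV f" "\<And>x. norm x < \<rho> \<Longrightarrow> f x \<ge> 0" and "\<rho> > 0"
    and box: "cball 0 (\<rho> + 1) \<subseteq> cbox a b"
    and int: "integral (cbox a b) (\<lambda>x. bump \<rho> x * f x) = 0" and x: "norm x < \<rho>"
  shows "f x = 0"
proof -
  have nonneg: "bump \<rho> y * f y \<ge> 0" for y
    using f(2)[of y] bump_nonneg[of \<rho> y] bump_eq_0[of \<rho> y] \<open>\<rho> > 0\<close> by (cases "norm y < \<rho>") auto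
  have cont: "continuous_on (cbox a b) (\<lambda>x. bump \<rho> x * f x)"
    by (intro continuous_intros continuous_on_bump continuous_on_subset[OF f(1)]) auto
  have "ball 0 (\<rho> + 1) \<subseteq> interior (cbox a b)"
    by (rule interior_maximal[OF _ open_ball]) (use box ball_subset_cball in blast)
  then have ne: "box a b \<noteq> {}"
    using \<open>\<rho> > 0\<close> by (auto simp: interior_cbox)
  have "((\<lambda>x. bump \<rho> x * f x) has_integral 0) (cbox a b)"
    using integrable_continuous[OF cont] int by (metis integrable_integral)
  moreover have "x \<in> cbox a b" using box x by (auto intro!: subsetD[OF box])
  ultimately have "bump \<rho> x * f x = 0"
    using has_integral_0_cbox_imp_0[OF cont nonneg _ ne] by blast
  then show ?thesis using bump_pos[OF x] by simp
qed

text \<open>Zeros spread from radius \<open>m\<close> to radius \<open>sqrt (m * r)\<close>: there \<open>|U(x)|\<^sup>2\<close> has the same weighted integral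
  as \<open>U(x / c) \<bullet> U(c x)\<close> with \<open>c = sqrt (r / m)\<close>, whose first factor vanishes.\<close>

lemma div_curl_free_unique_continuation:
  fixes U :: "'a::euclidean_space \<Rightarrow> 'a"
  assumes U: "div_curl_free r U U'" and "R > 0" and zero: "\<And>x. norm x < R \<Longrightarrow> U x = 0"
    and x: "norm x < r"
  shows "U x = 0"
proof -
  have cU: "continuous_on UNIV U"
    by (rule div_curl_free_continuous[OF U])
  have step: "U x = 0" if m: "0 < m" "m < r" "\<And>x. norm x < m \<Longrightarrow> U x = 0" and x: "norm x < sqrt (m * r)" for m x
  proof -
    define \<rho> where "\<rho> = sqrt (m * r)"
    have \<rho>: "\<rho> > 0" "\<rho> * \<rho> = m * r" using m by (auto simp: \<rho>_def)
    \<comment> \<open>With this T, dilation by exp(-T) takes the radius \<rho> to m, and dilation by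
      exp T takes it exactly to r, the limit of control over U.\<close>
    define T where "T = ln (r / \<rho>)"
    have "\<rho> * \<rho> \<le> r * r" using m \<rho> by simp
    then have "\<rho> \<le> r" using m by (meson abs_le_square_iff power2_eq_square dual_order.strict_trans less_imp_le real_sqrt_le_iff mult_strict_mono not_le)
    have eT: "exp T = r / \<rho>" "exp (- T) = \<rho> / r" "T \<ge> 0"
      using \<rho> m \<open>\<rho> \<le> r\<close> by (auto simp: T_def exp_minus)
    obtain c where c: "cball 0 (\<rho> + 1) \<subseteq> cbox (- c) (c :: 'a)"
      using bounded_subset_cbox_symmetric[OF bounded_cball] by blast
    have "integral (cbox (- c) c) (\<lambda>x. bump \<rho> x * (U (exp (- T) *\<^sub>R x) \<bullet> U (exp T *\<^sub>R x))) =
        integral (cbox (- c) c) (\<lambda>x. bump \<rho> x * (U x \<bullet> U x))"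
      by (rule div_curl_free_pairing_const[OF U U _ eT(3) \<open>\<rho> \<le> r\<close> _ c]) (use \<rho> eT in auto)
    moreover have "bump \<rho> x * (U (exp (- T) *\<^sub>R x) \<bullet> U (exp T *\<^sub>R x)) = 0" for x
    proof (cases "norm x < \<rho>")
      case True
      have "norm (exp (- T) *\<^sub>R x) = norm x * (\<rho> / r)" using eT \<rho> m by simp
      also have "\<dots> < \<rho> * (\<rho> / r)" using True \<rho> m by (intro mult_strict_right_mono) auto
      also have "\<dots> = m" using \<rho> m by (simp add: field_simps)
      finally show ?thesis using m(3) by simp
    qed (use \<rho> in \<open>simp add: bump_eq_0\<close>)
    ultimately have "integral (cbox (- c) c) (\<lambda>x. bump \<rho> x * (U x \<bullet> U x)) = 0"
      by simp
    then have "U x \<bullet> U x = 0"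
      by (intro integral_bump_eq_0D[where f="\<lambda>x. U x \<bullet> U x", OF _ _ \<rho>(1) c])
         (use x in \<open>auto simp: \<rho>_def intro!: continuous_intros cU\<close>)
    then show ?thesis by simp
  qed
  \<comment> \<open>The supremum replaces the iteration m -> sqrt(m r), which increases to r. U
    vanishes on the open ball of radius \<open>Sup M\<close> too, so a supremum below r could be
    improved by one more step.\<close>
  define M where "M = {m. 0 < m \<and> m \<le> r \<and> (\<forall>x. norm x < m \<longrightarrow> U x = 0)}"
  have "r > 0" using x norm_ge_zero[of x] by linarith
  have M: "min R r \<in> M"
    unfolding M_def mem_Collect_eq using \<open>R > 0\<close> \<open>r > 0\<close> zero by (intro conjI allI impI) simp_all
  then have ne: "M \<noteq> {}" by blast
  have bdd: "bdd_above M" by (rule bdd_aboveI[of _ r]) (simp add: M_def)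
  have pos: "Sup M > 0" using cSup_upper[OF M bdd] \<open>R > 0\<close> \<open>r > 0\<close> by linarith
  have le: "Sup M \<le> r"
    by (rule cSup_least[OF ne]) (simp add: M_def)
  have zS: "U x = 0" if less: "norm x < Sup M" for x
  proof -
    obtain m where "m \<in> M" "norm x < m" using less_cSupD[OF ne less] by blast
    then show ?thesis by (auto simp: M_def)
  qed
  have "Sup M = r"
  proof (rule ccontr)
    assume "Sup M \<noteq> r"
    then have lt: "Sup M < r" using le by simp
    have "sqrt (Sup M * r) \<le> sqrt (r * r)" using lt pos by (intro real_sqrt_le_mono mult_right_mono) auto
    then have "sqrt (Sup M * r) \<in> M"
      using step[OF pos lt zS] pos \<open>r > 0\<close> by (auto simp: M_def)
    then have "sqrt (Sup M * r) \<le> Sup M" by (rule cSup_upper[OF _ bdd])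
    moreover have "sqrt (Sup M * Sup M) < sqrt (Sup M * r)"
      using lt pos by (intro real_sqrt_less_mono mult_strict_left_mono) auto
    ultimately show False using pos by simp
  qed
  then show ?thesis using zS x by simp
qed

text \<open>A mean value argument: pairing with the constant field e shows that the weighted
  integral of U . e does not change when U is replaced by \<open>U (exp (- T) *\<^sub>R x)\<close>.
  For large T only values near \<open>U 0 = 0\<close> enter, so the integral is 0, and a nonnegative
  integrand must vanish.\<close>

lemma div_curl_free_local_extremum:
  fixes U :: "'a::euclidean_space \<Rightarrow> 'a"
  assumes U: "div_curl_free r U U'" and "r > 0" and U0: "U 0 = 0"
    and ext: "\<forall>\<^sub>F x in nhds 0. 0 \<le> U x \<bullet> e"
  shows "\<forall>\<^sub>F x in nhds 0. U x \<bullet> e = 0"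
proof -
  have cU: "continuous_on UNIV U"
    by (rule div_curl_free_continuous[OF U])
  obtain \<epsilon> where "\<epsilon> > 0" and \<epsilon>: "\<And>x. norm x < \<epsilon> \<Longrightarrow> 0 \<le> U x \<bullet> e"
    using ext unfolding eventually_nhds_metric by auto
  define \<rho> where "\<rho> = min r \<epsilon>"
  have \<rho>: "\<rho> > 0" "\<rho> \<le> r" "\<rho> \<le> \<epsilon>" using \<open>r > 0\<close> \<open>\<epsilon> > 0\<close> by (auto simp: \<rho>_def)
  obtain c where c: "cball 0 (\<rho> + 1) \<subseteq> cbox (- c) (c :: 'a)"
    using bounded_subset_cbox_symmetric[OF bounded_cball] by blast
  let ?I = "integral (cbox (- c) c) (\<lambda>x. bump \<rho> x * (U x \<bullet> e))"
  let ?C = "integral (cbox (- c) c) (bump \<rho>)"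
  have "\<bar>?I\<bar> \<le> \<eta> * ?C" if "\<eta> > 0" for \<eta>
  proof -
    have "isCont (\<lambda>x. U x \<bullet> e) 0"
      using cU by (intro continuous_intros) (simp add: continuous_on_eq_continuous_at)
    then obtain \<delta> where "\<delta> > 0" and \<delta>: "\<And>x. norm x < \<delta> \<Longrightarrow> \<bar>U x \<bullet> e\<bar> < \<eta>"
      using \<open>\<eta> > 0\<close> U0 unfolding continuous_at_eps_delta by (auto simp: dist_norm)
    \<comment> \<open>Chosen so that the ball of radius \<rho> is shrunk into the ball of radius
      \<delta>; the maximum with 1 keeps T nonnegative.\<close>
    define T where "T = ln (max 1 (\<rho> / \<delta>))"
    have T: "T \<ge> 0" "exp (- T) * \<rho> \<le> \<delta>"
    proof -
      show "T \<ge> 0" by (simp add: T_def)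
      have "exp T \<ge> \<rho> / \<delta>" by (simp add: T_def)
      then have "\<rho> \<le> \<delta> * exp T" using \<open>\<delta> > 0\<close> by (simp add: pos_divide_le_eq mult.commute)
      then show "exp (- T) * \<rho> \<le> \<delta>" by (simp add: exp_minus field_simps)
    qed
    \<comment> \<open>A constant field satisfies both equations on every ball, so nothing limits T
      from above.\<close>
    have W: "div_curl_free (\<rho> * exp T) (\<lambda>_. e) (\<lambda>_ _. 0)"
      by (auto simp: div_curl_free_def)
    have "integral (cbox (- c) c) (\<lambda>x. bump \<rho> x * (U (exp (- T) *\<^sub>R x) \<bullet> e)) = ?I"
      by (rule div_curl_free_pairing_const[OF U W _ T(1) \<rho>(2) _ c]) (use \<rho> in auto)
    moreover have "norm (integral (cbox (- c) c) (\<lambda>x. bump \<rho> x * (U (exp (- T) *\<^sub>R x) \<bullet> e)))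
        \<le> integral (cbox (- c) c) (\<lambda>x. \<eta> * bump \<rho> x)"
    proof (rule integral_norm_bound_integral)
      show "(\<lambda>x. bump \<rho> x * (U (exp (- T) *\<^sub>R x) \<bullet> e)) integrable_on cbox (- c) c"
        by (intro integrable_continuous continuous_intros continuous_on_bump continuous_on_compose2[OF cU]) auto
      show "(\<lambda>x. \<eta> * bump \<rho> x) integrable_on cbox (- c) c"
        by (intro integrable_continuous continuous_intros continuous_on_bump)
      fix x
      show "norm (bump \<rho> x * (U (exp (- T) *\<^sub>R x) \<bullet> e)) \<le> \<eta> * bump \<rho> x"
      proof (cases "norm x < \<rho>")
        case True
        then have "norm (exp (- T) *\<^sub>R x) < exp (- T) * \<rho>" by simp
        then have "norm (exp (- T) *\<^sub>R x) < \<delta>" using T by linarith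
        then have "\<bar>U (exp (- T) *\<^sub>R x) \<bullet> e\<bar> * bump \<rho> x \<le> \<eta> * bump \<rho> x"
          using \<delta> by (intro mult_right_mono bump_nonneg) (auto intro: less_imp_le)
        then show ?thesis by (simp add: abs_mult bump_nonneg mult.commute)
      next
        case False
        then show ?thesis using \<rho> by (simp add: bump_eq_0)
      qed
    qed
    ultimately show ?thesis by simp
  qed
  then have "?I = 0"
  proof -
    assume *: "\<And>\<eta>. \<eta> > 0 \<Longrightarrow> \<bar>?I\<bar> \<le> \<eta> * ?C"
    have "?C \<ge> 0" by (intro integral_nonneg integrable_continuous continuous_on_bump bump_nonneg)
    have "\<bar>?I\<bar> \<le> 0 + d" if "d > 0" for d
    proof -
      have "\<bar>?I\<bar> \<le> d / (1 + ?C) * ?C" 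
        by (rule *) (use \<open>?C \<ge> 0\<close> that in simp)
      also have "\<dots> \<le> d" using \<open>?C \<ge> 0\<close> that by (simp add: field_simps)
      finally show ?thesis by simp
    qed
    then show "?I = 0" using field_le_epsilon[of "\<bar>?I\<bar>" 0] by simp
  qed
  then have "U x \<bullet> e = 0" if "norm x < \<rho>" for x
    by (intro integral_bump_eq_0D[where f="\<lambda>x. U x \<bullet> e", OF _ _ \<rho>(1) c])
       (use \<epsilon> \<rho> that in \<open>auto intro!: continuous_intros cU\<close>)
  then show ?thesis
    unfolding eventually_nhds_metric using \<rho>(1) by auto
qed

text \<open>Some components may have a maximum and others a minimum, hence the passage through
  \<open>- e\<close>. Unique continuation carries the zeros from a neighbourhood of 0 to the whole
  ball.\<close>

lemma div_curl_free_eq_0: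
  fixes U :: "'a::euclidean_space \<Rightarrow> 'a"
  assumes U: "div_curl_free r U U'" and U0: "U 0 = 0"
    and ext: "\<And>e. e \<in> Basis \<Longrightarrow> (\<forall>\<^sub>F x in nhds 0. U x \<bullet> e \<le> 0) \<or> (\<forall>\<^sub>F x in nhds 0. 0 \<le> U x \<bullet> e)"
    and x: "norm x < r"
  shows "U x = 0"
proof -
  have "r > 0" using x norm_ge_zero[of x] by linarith
  have "\<forall>\<^sub>F x in nhds 0. U x \<bullet> e = 0" if "e \<in> Basis" for e
    using ext[OF that] div_curl_free_local_extremum[OF U \<open>r > 0\<close> U0, of e]
      div_curl_free_local_extremum[OF U \<open>r > 0\<close> U0, of "- e"] by auto
  then have "\<forall>\<^sub>F x in nhds 0. \<forall>e\<in>Basis. U x \<bullet> e = 0"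
    by (intro eventually_ball_finite) auto
  then have "\<forall>\<^sub>F x in nhds 0. U x = 0"
    by (rule eventually_mono) (simp add: euclidean_all_zero_iff)
  then obtain R where "R > 0" "\<And>x. norm x < R \<Longrightarrow> U x = 0"
    unfolding eventually_nhds_metric by auto
  then show ?thesis
    using div_curl_free_unique_continuation[OF U _ _ x] by blast
qed

section \<open>Periodic solutions\<close>

lemma has_derivative_advect:
  fixes f :: "vec3 \<Rightarrow> vec3"
  assumes "f differentiable (at y)"
  shows "(f has_derivative (\<lambda>h. advect h f y)) (at y)"
proof -
  obtain D where D: "(f has_derivative D) (at y)" using assms by (auto simp: differentiable_def)
  have lin: "linear D" using D by (rule has_derivative_linear)
  have p: "partial_y i f y = D (axis i 1)" for i
  proof -
    have "((\<lambda>t. y + t *\<^sub>R axis i 1) has_derivative (\<lambda>t. t *\<^sub>R axis i 1)) (at 0)"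
      by (auto intro!: derivative_eq_intros)
    from has_derivative_compose[OF this, of f D] D
    have "((\<lambda>t. f (y + t *\<^sub>R axis i 1)) has_derivative (\<lambda>t. t *\<^sub>R D (axis i 1))) (at 0)"
      by (simp add: linear_scale[OF lin])
    then show ?thesis
      unfolding partial_y_def by (intro vector_derivative_at) (simp add: has_vector_derivative_def)
  qed
  have "D h = advect h f y" for h
  proof -
    have "D h = D (\<Sum>i\<in>UNIV. h $ i *\<^sub>R axis i 1)"
      using basis_expansion[of h] by (simp add: scalar_mult_eq_scaleR)
    then show ?thesis by (simp add: advect_def p linear_sum[OF lin] linear_scale[OF lin])
  qed
  then have "D = (\<lambda>h. advect h f y)" by auto
  with D show ?thesis by simp
qed

text \<open>A majorant of the operator norm of the derivative that is visibly continuous when the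
  partial derivatives are. It controls vortex stretching, Lipschitz constants and the curl.\<close>

definition grad_norm :: "(vec3 \<Rightarrow> vec3) \<Rightarrow> vec3 \<Rightarrow> real" where
  "grad_norm f y = (\<Sum>i\<in>UNIV. norm (partial_y i f y))"

lemma norm_advect_le: "norm (advect h f y) \<le> grad_norm f y * norm h"
proof -
  have "norm (advect h f y) \<le> (\<Sum>i\<in>UNIV. norm (h $ i *\<^sub>R partial_y i f y))"
    unfolding advect_def by (rule norm_sum)
  also have "\<dots> \<le> (\<Sum>i\<in>UNIV. norm (partial_y i f y) * norm h)"
    using component_le_norm_cart[of h] by (intro sum_mono) (auto simp: mult.commute intro: mult_mono)
  finally show ?thesis by (simp add: grad_norm_def sum_distrib_right)
qed

lemma norm_curl_le: "norm (curl f y) \<le> 6 * grad_norm f y"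
proof -
  have c: "\<bar>partial_y i f y $ j\<bar> \<le> grad_norm f y" for i j
  proof -
    have "\<bar>partial_y i f y $ j\<bar> \<le> norm (partial_y i f y)" by (rule component_le_norm_cart)
    also have "\<dots> \<le> grad_norm f y" unfolding grad_norm_def by (rule member_le_sum) auto
    finally show ?thesis .
  qed
  have d: "\<bar>partial_y i f y $ j - partial_y k f y $ l\<bar> \<le> 2 * grad_norm f y" for i j k l
    using abs_triangle_ineq4[of "partial_y i f y $ j" "partial_y k f y $ l"] c[of i j] c[of k l] by simp
  have "norm (curl f y) \<le> (\<Sum>i\<in>UNIV. \<bar>curl f y $ i\<bar>)" by (rule norm_le_l1_cart)
  also have "\<dots> = \<bar>curl f y $ 1\<bar> + \<bar>curl f y $ 2\<bar> + \<bar>curl f y $ 3\<bar>" by (simp add: sum_3)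
  also have "\<dots> \<le> 2 * grad_norm f y + 2 * grad_norm f y + 2 * grad_norm f y"
    unfolding curl_nth by (intro add_mono d)
  also have "\<dots> = 6 * grad_norm f y" by simp
  finally show ?thesis .
qed

lemma advect_symmetric:
  assumes "curl f y = 0"
  shows "advect h f y \<bullet> k = advect k f y \<bullet> h"
proof -
  have "curl f y $ 1 = 0" "curl f y $ 2 = 0" "curl f y $ 3 = 0" using assms by simp_all
  then have "partial_y 2 f y $ 3 = partial_y 3 f y $ 2" "partial_y 3 f y $ 1 = partial_y 1 f y $ 3"
    "partial_y 1 f y $ 2 = partial_y 2 f y $ 1"
    by (simp_all add: curl_nth)
  then show ?thesis
    by (simp add: advect_def inner_vec_def sum_3 algebra_simps)
qed

lemma trace_advect: "(\<Sum>i\<in>Basis. advect i f y \<bullet> i) = div_y f y"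
proof -
  have B: "(Basis :: vec3 set) = (\<lambda>i. axis i 1) ` UNIV"
    by (auto simp: Basis_vec_def)
  have "inj (\<lambda>i::3. axis i (1::real))" by (auto simp: inj_def axis_eq_axis)
  then have "(\<Sum>i\<in>Basis. advect i f y \<bullet> i) = (\<Sum>i\<in>UNIV. advect (axis i 1) f y $ i)"
    unfolding B by (simp add: sum.reindex inner_axis)
  also have "\<dots> = div_y f y"
    unfolding div_y_def
    by (intro sum.cong refl) (simp add: advect_def axis_def if_distrib[of "\<lambda>x. x * _"] cong: if_cong)
  finally show ?thesis .
qed

section \<open>Time periodic functions: estimates uniform in time\<close>

lemma periodic_uniformly_continuous:
  fixes F :: "'a::euclidean_space \<Rightarrow> real \<Rightarrow> 'b::metric_space"
  assumes F: "continuous_on UNIV (\<lambda>(y, s). F y s)" and "S > 0" and per: "\<And>y s. F y (s + S) = F y s"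
    and "\<epsilon> > 0"
  shows "\<exists>\<eta>>0. \<forall>y z s. norm y \<le> R \<longrightarrow> norm z \<le> R \<longrightarrow> dist y z < \<eta> \<longrightarrow> dist (F y s) (F z s) < \<epsilon>"
proof -
  have "uniformly_continuous_on (cball 0 R \<times> {0..S}) (\<lambda>(y, s). F y s)"
    by (intro compact_uniformly_continuous continuous_on_subset[OF F] compact_Times) auto
  then obtain \<eta> where "\<eta> > 0" and \<eta>: "\<And>p q. p \<in> cball 0 R \<times> {0..S} \<Longrightarrow> q \<in> cball 0 R \<times> {0..S} \<Longrightarrow>
      dist p q < \<eta> \<Longrightarrow> dist (case p of (y, s) \<Rightarrow> F y s) (case q of (y, s) \<Rightarrow> F y s) < \<epsilon>"
    using \<open>\<epsilon> > 0\<close> unfolding uniformly_continuous_on_def by metis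
  have "dist (F y s) (F z s) < \<epsilon>" if "norm y \<le> R" "norm z \<le> R" "dist y z < \<eta>" for y z s
  proof -
    obtain t where "0 \<le> t" "t < S" "\<And>y. F y s = F y t"
      using periodic_reduce[where F=F, OF \<open>S > 0\<close> per] by blast
    then show ?thesis using \<eta>[of "(z, t)" "(y, t)"] \<eta>[of "(y, t)" "(z, t)"] that by (simp add: dist_Pair_Pair)
  qed
  then show ?thesis using \<open>\<eta> > 0\<close> by blast
qed

lemma periodic_bounded:
  fixes F :: "'a::euclidean_space \<Rightarrow> real \<Rightarrow> 'b::real_normed_vector"
  assumes F: "continuous_on UNIV (\<lambda>(y, s). F y s)" and "S > 0" and per: "\<And>y s. F y (s + S) = F y s"
  shows "\<exists>L. \<forall>y s. norm y \<le> R \<longrightarrow> norm (F y s) \<le> L"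
proof -
  have "compact ((\<lambda>(y, s). F y s) ` (cball 0 R \<times> {0..S}))"
    by (intro compact_continuous_image continuous_on_subset[OF F] compact_Times) auto
  then obtain L where L: "\<And>x. x \<in> (\<lambda>(y, s). F y s) ` (cball 0 R \<times> {0..S}) \<Longrightarrow> norm x \<le> L"
    using compact_imp_bounded bounded_iff by metis
  have "norm (F y s) \<le> L" if "norm y \<le> R" for y s
  proof -
    obtain t where t: "0 \<le> t" "t < S" "\<And>y. F y s = F y t"
      using periodic_reduce[where F=F, OF \<open>S > 0\<close> per] by blast
    have "(y, t) \<in> cball 0 R \<times> {0..S}" using t that by simp
    then have "norm (F y t) \<le> L" using L by force
    then show ?thesis using t by simp
  qed
  then show ?thesis by blast
qed

text \<open>Carries closed conditions from the open period to all times; closedness supplies the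
  endpoint t = 0.\<close>

lemma periodic_closed:
  fixes F :: "'a::topological_space \<Rightarrow> real \<Rightarrow> 'b::topological_space"
  assumes F: "continuous_on UNIV (\<lambda>(y, s). F y s)" and "S > 0" and per: "\<And>y s. F y (s + S) = F y s"
    and C: "closed C" "\<And>s. s \<in> {0<..<S} \<Longrightarrow> F y s \<in> C"
  shows "F y s \<in> C"
proof -
  obtain t where t: "0 \<le> t" "t < S" "\<And>y. F y s = F y t"
    using periodic_reduce[where F=F, OF \<open>S > 0\<close> per] by blast
  have "continuous_on UNIV (\<lambda>t. (y, t))"
    by (rule continuous_on_Pair[OF continuous_on_const continuous_on_id])
  then have "continuous_on UNIV (\<lambda>t. F y t)"
    using continuous_on_compose2[OF F, of UNIV "\<lambda>t. (y, t)"] by simp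
  then have "closed ((\<lambda>t. F y t) -` C)"
    using C(1) by (simp add: continuous_closed_vimage continuous_on_eq_continuous_at)
  then have "closure {0<..<S} \<subseteq> (\<lambda>t. F y t) -` C"
    by (intro closure_minimal) (use C(2) in auto)
  then have "F y t \<in> C" using t \<open>S > 0\<close> by (auto simp: subset_iff)
  then show ?thesis using t by simp
qed

text \<open>Join 0 to y by three segments parallel to the axes, which gives the factor 3. All points
  on them have coordinates bounded by those of y, so their norm is at most \<open>norm y\<close>.
  Only partial derivatives are involved, and these are all that \<open>spatial_C\<close>
  provides.\<close>

lemma norm_le_partial_bound:
  fixes g :: "vec3 \<Rightarrow> 'b::real_normed_vector"
  assumes diff: "\<And>i y. norm y < \<rho> \<Longrightarrow> has_partial_y i g y"
    and bound: "\<And>i y. norm y < \<rho> \<Longrightarrow> norm (partial_y i g y) \<le> C * norm y ^ j"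
    and "C \<ge> 0" and g0: "g 0 = 0" and y: "norm y < \<rho>"
  shows "norm (g y) \<le> 3 * C * norm y ^ Suc j"
proof -
  have step: "norm (g (x + t *\<^sub>R axis i 1) - g x) \<le> C * norm y ^ Suc j"
    if x: "\<And>l. \<bar>x $ l\<bar> \<le> \<bar>y $ l\<bar>" "x $ i = 0" and t: "\<bar>t\<bar> \<le> \<bar>y $ i\<bar>" for x t i
  proof -
    have nle: "norm (x + \<tau> *\<^sub>R axis i 1) \<le> norm y" if "\<bar>\<tau>\<bar> \<le> \<bar>t\<bar>" for \<tau>
      by (rule norm_le_componentwise_cart) (use x t that in \<open>auto simp: axis_def\<close>)
    have d: "((\<lambda>\<tau>. g (x + \<tau> *\<^sub>R axis i 1)) has_vector_derivative partial_y i g (x + \<tau> *\<^sub>R axis i 1)) (at \<tau>)"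
      if "\<bar>\<tau>\<bar> \<le> \<bar>t\<bar>" for \<tau>
    proof -
      have "norm (x + \<tau> *\<^sub>R axis i 1) < \<rho>" using nle[OF that] y by simp
      from diff[OF this, of i]
      have "((\<lambda>u. g (x + \<tau> *\<^sub>R axis i 1 + u *\<^sub>R axis i 1)) has_vector_derivative partial_y i g (x + \<tau> *\<^sub>R axis i 1)) (at (\<tau> - \<tau>))"
        by (simp add: has_partial_y_def partial_y_def vector_derivative_works)
      moreover have "((\<lambda>u. u - \<tau>) has_vector_derivative 1) (at \<tau>)"
        by (auto intro!: derivative_eq_intros simp: has_vector_derivative_def)
      ultimately have "((\<lambda>u. g (x + \<tau> *\<^sub>R axis i 1 + u *\<^sub>R axis i 1)) \<circ> (\<lambda>u. u - \<tau>) has_vector_derivative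
          1 *\<^sub>R partial_y i g (x + \<tau> *\<^sub>R axis i 1)) (at \<tau>)"
        by (intro vector_diff_chain_at)
      then show ?thesis by (simp add: o_def algebra_simps)
    qed
    define J where "J = {- \<bar>t\<bar>..\<bar>t\<bar>}"
    have "norm (g (x + t *\<^sub>R axis i 1) - g (x + 0 *\<^sub>R axis i 1)) \<le> (C * norm y ^ j) * norm (t - 0)"
    proof (rule differentiable_bound[where f="\<lambda>\<tau>. g (x + \<tau> *\<^sub>R axis i 1)" and S=J])
      fix \<tau> assume "\<tau> \<in> J"
      then have \<tau>: "\<bar>\<tau>\<bar> \<le> \<bar>t\<bar>" by (auto simp: J_def)
      show "((\<lambda>\<tau>. g (x + \<tau> *\<^sub>R axis i 1)) has_derivative (\<lambda>u. u *\<^sub>R partial_y i g (x + \<tau> *\<^sub>R axis i 1))) (at \<tau> within J)"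
        using d[OF \<tau>] by (simp add: has_vector_derivative_def has_derivative_at_withinI)
      have "norm (partial_y i g (x + \<tau> *\<^sub>R axis i 1)) \<le> C * norm (x + \<tau> *\<^sub>R axis i 1) ^ j"
        by (rule bound) (use nle[OF \<tau>] y in simp)
      also have "\<dots> \<le> C * norm y ^ j"
        using nle[OF \<tau>] \<open>C \<ge> 0\<close> by (intro mult_left_mono power_mono) auto
      finally show "onorm (\<lambda>u. u *\<^sub>R partial_y i g (x + \<tau> *\<^sub>R axis i 1)) \<le> C * norm y ^ j"
        by (intro onorm_le) (simp add: mult.commute mult_left_mono)
    qed (auto simp: J_def)
    also have "\<dots> \<le> (C * norm y ^ j) * norm y"
      using component_le_norm_cart[of y i] t \<open>C \<ge> 0\<close> by (intro mult_left_mono) auto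
    finally show ?thesis by (simp add: mult_ac)
  qed
  define p1 where "p1 = 0 + (y $ 1) *\<^sub>R (axis 1 1 :: vec3)"
  define p2 where "p2 = p1 + (y $ 2) *\<^sub>R axis 2 1"
  have p3: "y = p2 + (y $ 3) *\<^sub>R axis 3 1"
    by (simp add: p2_def p1_def vec_eq_iff forall_3 axis_def)
  have "norm (g p1 - g 0) \<le> C * norm y ^ Suc j"
    unfolding p1_def by (rule step) (auto simp: axis_def)
  moreover have "norm (g p2 - g p1) \<le> C * norm y ^ Suc j"
    unfolding p2_def by (rule step) (auto simp: p1_def axis_def)
  moreover have "norm (g y - g p2) \<le> C * norm y ^ Suc j"
    by (subst p3, rule step) (auto simp: p1_def p2_def axis_def)
  moreover have "norm (g y) \<le> norm (g p1 - g 0) + norm (g p2 - g p1) + norm (g y - g p2)"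
    using norm_triangle_ineq[of "g p1 - g 0" "g p2 - g p1"]
      norm_triangle_ineq[of "g p1 - g 0 + (g p2 - g p1)" "g y - g p2"] g0 by simp
  ultimately show ?thesis by linarith
qed

text \<open>A Taylor estimate by descent in the order of differentiation: derivatives of order n are
  bounded, and each integration from the origin, where all of them vanish, gains one power of
  |y|.\<close>

lemma partials_y_flat:
  fixes W :: "vec3 \<Rightarrow> real \<Rightarrow> 'b::real_normed_vector"
  assumes C: "spatial_C n W (ball 0 \<rho>) I" and B: "spatial_bounded n W (ball 0 \<rho>) I"
    and zero: "\<And>is s. length is \<le> n \<Longrightarrow> s \<in> I \<Longrightarrow> partials_y is (\<lambda>z. W z s) 0 = 0"
  shows "length is + j = n \<Longrightarrow> \<exists>K\<ge>0. \<forall>y s. norm y < \<rho> \<longrightarrow> s \<in> I \<longrightarrow>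
    norm (partials_y is (\<lambda>z. W z s) y) \<le> K * norm y ^ j"
proof (induction j arbitrary: "is")
  case 0
  then have "bounded ((\<lambda>(y, s). partials_y is (\<lambda>z. W z s) y) ` (ball 0 \<rho> \<times> I))"
    using B by (simp add: spatial_bounded_def)
  then obtain K where K: "\<And>x. x \<in> (\<lambda>(y, s). partials_y is (\<lambda>z. W z s) y) ` (ball 0 \<rho> \<times> I) \<Longrightarrow> norm x \<le> K"
    unfolding bounded_iff by blast
  have "norm (partials_y is (\<lambda>z. W z s) y) \<le> max K 0" if "norm y < \<rho>" "s \<in> I" for y s
  proof -
    have "(y, s) \<in> ball 0 \<rho> \<times> I" using that by simp
    then have "norm (partials_y is (\<lambda>z. W z s) y) \<le> K" by (intro K) force
    then show ?thesis by simp
  qed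
  then show ?case by (intro exI[of _ "max K 0"]) simp
next
  case (Suc j)
  have "\<forall>i. \<exists>K\<ge>0. \<forall>y s. norm y < \<rho> \<longrightarrow> s \<in> I \<longrightarrow> norm (partials_y (i # is) (\<lambda>z. W z s) y) \<le> K * norm y ^ j"
    using Suc.IH[of "_ # is"] Suc.prems by simp
  then obtain K where K: "\<And>i. K i \<ge> 0"
    "\<And>i y s. norm y < \<rho> \<Longrightarrow> s \<in> I \<Longrightarrow> norm (partials_y (i # is) (\<lambda>z. W z s) y) \<le> K i * norm y ^ j"
    by metis
  define KK where "KK = (\<Sum>i\<in>UNIV. K i)"
  have "KK \<ge> 0" unfolding KK_def using K(1) by (intro sum_nonneg) auto
  have le: "K i \<le> KK" for i unfolding KK_def using K(1) by (intro member_le_sum) auto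
  have "norm (partials_y is (\<lambda>z. W z s) y) \<le> 3 * KK * norm y ^ Suc j" if y: "norm y < \<rho>" and s: "s \<in> I" for y s
  proof (rule norm_le_partial_bound[OF _ _ \<open>KK \<ge> 0\<close> _ y])
    fix i and x :: vec3 assume x: "norm x < \<rho>"
    show "has_partial_y i (partials_y is (\<lambda>z. W z s)) x"
      using C x s Suc.prems by (simp add: spatial_C_def)
    have "norm (partial_y i (partials_y is (\<lambda>z. W z s)) x) \<le> K i * norm x ^ j"
      using K(2)[OF x s, of i] by simp
    also have "\<dots> \<le> KK * norm x ^ j" using le by (intro mult_right_mono) auto
    finally show "norm (partial_y i (partials_y is (\<lambda>z. W z s)) x) \<le> KK * norm x ^ j" .
  qed (use zero s Suc.prems in simp)
  then show ?case using \<open>KK \<ge> 0\<close> by (intro exI[of _ "3 * KK"]) auto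
qed

section \<open>A fixed periodic solution: vorticity decay around the origin\<close>

locale euler_periodic =
  fixes a b \<delta> S0 :: real and V :: "vec3 \<Rightarrow> real \<Rightarrow> vec3" and P :: "vec3 \<Rightarrow> real \<Rightarrow> real"
  assumes b_nz: "b \<noteq> 0" and S0_pos: "S0 > 0"
    and V_C1: "C1_s_C1_holder \<delta> V"
    and curl_C1: "C1_spacetime (\<lambda>y s. curl (\<lambda>z. V z s) y)"
    and solution: "time_periodic_solution a b S0 V P"
begin

definition vorticity :: "vec3 \<Rightarrow> real \<Rightarrow> vec3" where
  "vorticity y s = curl (\<lambda>z. V z s) y"

definition gradV :: "vec3 \<Rightarrow> real \<Rightarrow> real" where
  "gradV y s = grad_norm (\<lambda>z. V z s) y"

lemma sol: "is_solution a b V P"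
  using solution by (simp add: time_periodic_solution_def)

lemma V_periodic: "V y (s + S0) = V y s"
  using solution by (simp add: time_periodic_solution_def)

lemma vorticity_periodic: "vorticity y (s + S0) = vorticity y s"
  by (simp add: vorticity_def V_periodic)

lemma gradV_periodic: "gradV y (s + S0) = gradV y s"
  by (simp add: gradV_def V_periodic)

lemma V_spatial: "spatial_C 1 V UNIV UNIV"
  using V_C1 by (simp add: C1_s_C1_holder_def)

lemma V_continuous: "continuous_on UNIV (\<lambda>(y, s). V y s)"
  using V_spatial by (auto simp: spatial_C_def dest: spec[of _ "[]"])

lemma partial_V_continuous: "continuous_on UNIV (\<lambda>(y, s). partial_y i (\<lambda>z. V z s) y)"
  using V_spatial by (auto simp: spatial_C_def dest: spec[of _ "[i]"])

lemma gradV_continuous: "continuous_on UNIV (\<lambda>(y, s). gradV y s)"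
  using partial_V_continuous unfolding gradV_def grad_norm_def split_beta
  by (intro continuous_intros) auto

lemma vorticity_continuous: "continuous_on UNIV (\<lambda>(y, s). vorticity y s)"
proof -
  obtain F' :: "vec3 \<times> real \<Rightarrow> (vec3 \<times> real) \<Rightarrow>\<^sub>L vec3"
    where F': "\<And>p. ((\<lambda>(y, s). vorticity y s) has_derivative blinfun_apply (F' p)) (at p)"
    using curl_C1 unfolding C1_spacetime_def vorticity_def by auto
  then show ?thesis
    by (intro has_derivative_continuous_on[where f'="\<lambda>p. blinfun_apply (F' p)"]) simp
qed

lemma V_derivative: "((\<lambda>z. V z s) has_derivative (\<lambda>h. advect h (\<lambda>z. V z s) y)) (at y)"
  using sol by (intro has_derivative_advect) (simp add: is_solution_def)

lemma V_lipschitz: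
  assumes "convex A" "y \<in> A" "z \<in> A" "\<And>x. x \<in> A \<Longrightarrow> gradV x s \<le> L"
  shows "norm (V y s - V z s) \<le> L * norm (y - z)"
proof (rule differentiable_bound[OF assms(1) _ _ assms(2,3)])
  fix x assume x: "x \<in> A"
  show "((\<lambda>z. V z s) has_derivative (\<lambda>h. advect h (\<lambda>z. V z s) x)) (at x within A)"
    by (rule has_derivative_at_withinI[OF V_derivative])
  show "onorm (\<lambda>h. advect h (\<lambda>z. V z s) x) \<le> L"
  proof (rule onorm_le)
    fix h
    have "norm (advect h (\<lambda>z. V z s) x) \<le> gradV x s * norm h"
      unfolding gradV_def by (rule norm_advect_le)
    also have "\<dots> \<le> L * norm h" using assms(4)[OF x] by (intro mult_right_mono) auto
    finally show "norm (advect h (\<lambda>z. V z s) x) \<le> L * norm h" .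
  qed
qed

text \<open>Pairing the vorticity equation with \<Omega>, the linear term gives -(a + b)|\<Omega>|^2
  and stretching at most L|\<Omega>|^2 in absolute value. The factor \<open>sgn b\<close> reverses
  the flow when b < 0, so that the field always points outwards.\<close>

lemma vorticity_vanishes:
  assumes "\<theta> > 0" "k \<ge> 0" and rate: "L - sgn b * (a + b) < k * \<theta>"
    and gradV: "\<And>y s. norm y \<le> R \<Longrightarrow> gradV y s \<le> L"
    and out: "\<And>y s. norm y \<le> R \<Longrightarrow> \<theta> * (y \<bullet> y) \<le> sgn b * ((b *\<^sub>R y + V y s) \<bullet> y)"
    and small: "\<And>\<epsilon>. \<epsilon> > 0 \<Longrightarrow> \<exists>r>0. \<forall>y s. norm y < r \<longrightarrow> (vorticity y s \<bullet> vorticity y s) * (y \<bullet> y) powr (- k) \<le> \<epsilon>"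
    and y: "norm y \<le> R" "y \<noteq> 0"
  shows "vorticity y s = 0"
proof -
  obtain F' :: "vec3 \<times> real \<Rightarrow> (vec3 \<times> real) \<Rightarrow>\<^sub>L vec3"
    where F': "\<And>p. ((\<lambda>(y, s). curl (\<lambda>z. V z s) y) has_derivative blinfun_apply (F' p)) (at p)"
      and F'_cont: "continuous_on UNIV F'"
    using curl_C1 unfolding C1_spacetime_def by auto
  have "(\<lambda>(y, s). curl (\<lambda>z. V z s) y) (y, s) = 0"
  proof (rule transport_vanishing[where B="\<lambda>(y, s). b *\<^sub>R y + V y s" and \<sigma>="sgn b" and \<theta>=\<theta> and k=k
        and c="L - sgn b * (a + b)" and S=S0 and W'="\<lambda>p. blinfun_apply (F' p)" and R=R])
    fix y :: vec3 and s assume y: "norm y \<le> R"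
    have eq: "blinfun_apply (F' (y, s)) (b *\<^sub>R y + V y s, 1) = - (a + b) *\<^sub>R vorticity y s + advect (vorticity y s) (\<lambda>z. V z s) y"
      unfolding vorticity_def by (rule vorticity_equation[OF V_C1 sol F' F'_cont])
    have "sgn b * (vorticity y s \<bullet> F' (y, s) (b *\<^sub>R y + V y s, 1)) =
        - sgn b * (a + b) * (vorticity y s \<bullet> vorticity y s) + sgn b * (vorticity y s \<bullet> advect (vorticity y s) (\<lambda>z. V z s) y)"
      unfolding eq by (simp add: inner_add_right algebra_simps)
    also have "sgn b * (vorticity y s \<bullet> advect (vorticity y s) (\<lambda>z. V z s) y) \<le> \<bar>sgn b * (vorticity y s \<bullet> advect (vorticity y s) (\<lambda>z. V z s) y)\<bar>"
      by simp
    also have "\<dots> = \<bar>vorticity y s \<bullet> advect (vorticity y s) (\<lambda>z. V z s) y\<bar>"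
      using b_nz by (simp add: abs_mult)
    also have "\<dots> \<le> norm (vorticity y s) * norm (advect (vorticity y s) (\<lambda>z. V z s) y)"
      by (rule Cauchy_Schwarz_ineq2)
    also have "\<dots> \<le> norm (vorticity y s) * (gradV y s * norm (vorticity y s))"
      unfolding gradV_def by (intro mult_left_mono norm_advect_le) auto
    also have "\<dots> = gradV y s * (vorticity y s \<bullet> vorticity y s)"
      by (simp add: dot_square_norm power2_eq_square)
    also have "\<dots> \<le> L * (vorticity y s \<bullet> vorticity y s)"
      using gradV[OF y] by (intro mult_right_mono) auto
    finally show "sgn b * ((case (y, s) of (y, s) \<Rightarrow> curl (\<lambda>z. V z s) y) \<bullet>
        blinfun_apply (F' (y, s)) (case (y, s) of (y, s) \<Rightarrow> b *\<^sub>R y + V y s, 1))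
        \<le> (L - sgn b * (a + b)) * ((case (y, s) of (y, s) \<Rightarrow> curl (\<lambda>z. V z s) y) \<bullet> (case (y, s) of (y, s) \<Rightarrow> curl (\<lambda>z. V z s) y))"
      by (simp add: vorticity_def algebra_simps)
  qed (use assms S0_pos F'[unfolded split_beta] vorticity_periodic in \<open>simp_all add: vorticity_def split_beta\<close>)
  then show ?thesis by (simp add: vorticity_def)
qed

lemma outward:
  assumes "norm (V y s) \<le> L * norm y" "\<theta> + L \<le> \<bar>b\<bar>"
  shows "\<theta> * (y \<bullet> y) \<le> sgn b * ((b *\<^sub>R y + V y s) \<bullet> y)"
proof -
  have "\<bar>sgn b * (V y s \<bullet> y)\<bar> = \<bar>V y s \<bullet> y\<bar>" using b_nz by (simp add: abs_mult)
  also have "\<dots> \<le> norm (V y s) * norm y" by (rule Cauchy_Schwarz_ineq2)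
  also have "\<dots> \<le> L * norm y * norm y" using assms(1) by (intro mult_right_mono) auto
  also have "\<dots> = L * (y \<bullet> y)" by (simp add: dot_square_norm power2_eq_square)
  finally have "- (L * (y \<bullet> y)) \<le> sgn b * (V y s \<bullet> y)" by linarith
  moreover have "\<theta> * (y \<bullet> y) + L * (y \<bullet> y) \<le> \<bar>b\<bar> * (y \<bullet> y)"
    unfolding distrib_right[symmetric] using assms(2) by (intro mult_right_mono) auto
  moreover have "sgn b * ((b *\<^sub>R y + V y s) \<bullet> y) = \<bar>b\<bar> * (y \<bullet> y) + sgn b * (V y s \<bullet> y)"
    by (simp add: inner_add_left distrib_left abs_sgn mult_ac)
  ultimately show ?thesis by linarith
qed

lemma div_curl_freeI:
  assumes "\<And>x. norm x < r \<Longrightarrow> vorticity x s = 0"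
  shows "div_curl_free r (\<lambda>z. V z s) (\<lambda>y h. advect h (\<lambda>z. V z s) y)"
  unfolding div_curl_free_def
proof (intro conjI allI impI)
  show "continuous_on UNIV (\<lambda>y. advect h (\<lambda>z. V z s) y)" for h
  proof -
    have "continuous_on UNIV (\<lambda>y. partial_y i (\<lambda>z. V z s) y)" for i
      using continuous_on_compose2[OF partial_V_continuous[of i], of UNIV "\<lambda>y. (y, s)"]
      by (simp add: continuous_on_Pair[OF continuous_on_id continuous_on_const])
    then show ?thesis unfolding advect_def by (intro continuous_intros)
  qed
  show "advect h (\<lambda>z. V z s) x \<bullet> k = advect k (\<lambda>z. V z s) x \<bullet> h" if "norm x < r" for x h k
    using assms[OF that] by (intro advect_symmetric) (simp add: vorticity_def)
  show "(\<Sum>i\<in>Basis. advect i (\<lambda>z. V z s) x \<bullet> i) = 0" for x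
    using sol by (simp add: trace_advect is_solution_def)
qed (rule V_derivative)

lemma vorticity_vanishes_near_0:
  assumes V0: "\<And>s. V 0 s = 0" and N0: "\<And>s. gradV 0 s = 0"
    and "k \<ge> 0" and rate: "0 < sgn b * (a + b) + k * \<bar>b\<bar>"
    and small: "\<And>\<epsilon>. \<epsilon> > 0 \<Longrightarrow> \<exists>r>0. \<forall>y s. norm y < r \<longrightarrow> (vorticity y s \<bullet> vorticity y s) * (y \<bullet> y) powr (- k) \<le> \<epsilon>"
  shows "\<exists>r>0. \<forall>y s. norm y < r \<longrightarrow> vorticity y s = 0"
proof -
  \<comment> \<open>\<kappa> bounds both the gradient of V and |V|/|y|, leaving the outward rate
    \<theta> = |b| - \<kappa>. Positivity of \<theta> explains |b|/2; the second entry ensures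
    \<kappa> - sgn(b)(a + b) < k(|b| - \<kappa>), its factor 2 giving strictness.\<close>
  define \<kappa> where "\<kappa> = min (\<bar>b\<bar> / 2) ((sgn b * (a + b) + k * \<bar>b\<bar>) / (2 * (1 + k)))"
  have \<kappa>: "\<kappa> > 0" "\<kappa> < \<bar>b\<bar>" "\<kappa> * (2 * (1 + k)) \<le> sgn b * (a + b) + k * \<bar>b\<bar>"
  proof -
    have k: "2 * (1 + k) > 0" using \<open>k \<ge> 0\<close> by simp
    then show "\<kappa> > 0" unfolding \<kappa>_def min_less_iff_conj
      using rate b_nz by (intro conjI divide_pos_pos) auto
    show "\<kappa> < \<bar>b\<bar>" using b_nz by (simp add: \<kappa>_def min_less_iff_disj)
    have "\<kappa> \<le> (sgn b * (a + b) + k * \<bar>b\<bar>) / (2 * (1 + k))" by (simp add: \<kappa>_def)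
    with k show "\<kappa> * (2 * (1 + k)) \<le> sgn b * (a + b) + k * \<bar>b\<bar>"
      by (simp only: pos_le_divide_eq)
  qed
  obtain \<eta> where "\<eta> > 0" and \<eta>: "\<And>y z s. norm y \<le> 1 \<Longrightarrow> norm z \<le> 1 \<Longrightarrow> dist y z < \<eta> \<Longrightarrow> dist (gradV y s) (gradV z s) < \<kappa>"
    using periodic_uniformly_continuous[OF gradV_continuous S0_pos gradV_periodic \<kappa>(1), of 1] by blast
  define r where "r = min 1 (\<eta> / 2)"
  have r: "r > 0" "r \<le> 1" "r < \<eta>" using \<open>\<eta> > 0\<close> by (auto simp: r_def)
  have gradV\<kappa>: "gradV y s \<le> \<kappa>" if "norm y \<le> r" for y s
    using \<eta>[of y 0 s] that r N0 by (simp add: dist_real_def)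
  have V\<kappa>: "norm (V y s) \<le> \<kappa> * norm y" if "norm y \<le> r" for y s
    using V_lipschitz[of "cball 0 r" y 0 s \<kappa>] gradV\<kappa> that r V0 by simp
  have "vorticity y s = 0" if "norm y \<le> r" "y \<noteq> 0" for y s
  proof (rule vorticity_vanishes[of "\<bar>b\<bar> - \<kappa>" k \<kappa> r, OF _ \<open>k \<ge> 0\<close> _ gradV\<kappa> _ small that])
    show "\<kappa> - sgn b * (a + b) < k * (\<bar>b\<bar> - \<kappa>)"
    proof -
      have "\<kappa> - x < k * (B - \<kappa>)" if "\<kappa> * (2 * (1 + k)) \<le> x + k * B" for x B
      proof -
        have "\<kappa> * (2 * (1 + k)) = 2 * \<kappa> + 2 * (\<kappa> * k)" by (simp add: distrib_left)
        moreover have "k * (B - \<kappa>) = k * B - \<kappa> * k" by (simp add: right_diff_distrib)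
        moreover have "\<kappa> * k \<ge> 0" using \<kappa>(1) \<open>k \<ge> 0\<close> by simp
        ultimately show ?thesis using \<kappa>(1) that by linarith
      qed
      from this[OF \<kappa>(3)] show ?thesis .
    qed
    show "(\<bar>b\<bar> - \<kappa>) * (y \<bullet> y) \<le> sgn b * ((b *\<^sub>R y + V y s) \<bullet> y)" if "norm y \<le> r" for y s
      by (rule outward[OF V\<kappa>[OF that]]) simp
  qed (use \<kappa> in auto)
  \<comment> \<open>The weighted maximum principle says nothing at y = 0; there the curl vanishes
    with the gradient.\<close>
  moreover have "vorticity 0 s = 0" for s
    using norm_curl_le[of "\<lambda>z. V z s" 0] N0[of s] by (simp add: vorticity_def gradV_def)
  ultimately show ?thesis using r by (metis less_imp_le)
qed

text \<open>Just outside the ball V is still small by Lipschitz continuity, so by + V still points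
  outwards (inwards if b < 0). The gradient of V need not be small there, but k may be taken large
  enough to beat it, because \<Omega> vanishes near the origin.\<close>

lemma extend:
  assumes "R > 0" and zero: "\<And>y s. norm y < R \<Longrightarrow> V y s = 0"
  shows "\<exists>R'>R. \<forall>y s. norm y < R' \<longrightarrow> V y s = 0"
proof -
  have zero': "V y s = 0" if "norm y \<le> R" for y s
  proof -
    have cV: "continuous_on UNIV (\<lambda>y. V y s)"
      by (rule has_derivative_continuous_on[where f'="\<lambda>y h. advect h (\<lambda>z. V z s) y"]) (simp add: V_derivative)
    have "closed ((\<lambda>y. V y s) -` {0})"
      using cV by (simp add: continuous_closed_vimage continuous_on_eq_continuous_at)
    then have "closure (ball 0 R) \<subseteq> (\<lambda>y. V y s) -` {0}"
      by (intro closure_minimal) (auto simp: zero)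
    then show ?thesis using that \<open>R > 0\<close> by (auto simp: subset_iff)
  qed
  obtain L where L: "\<And>y s. norm y \<le> R + 1 \<Longrightarrow> norm (gradV y s) \<le> L"
    using periodic_bounded[OF gradV_continuous S0_pos gradV_periodic] by blast
  have N_le: "gradV y s \<le> L" if "norm y \<le> R + 1" for y s
    using L[OF that, of s] by (simp add: abs_le_iff)
  have "L \<ge> 0" using L[of 0 0] \<open>R > 0\<close> by (simp add: order_trans[OF norm_ge_zero])
  \<comment> \<open>In the shell |V| \<le> L\<eta> \<le> |b|R/2 \<le> |b||y|/2, so at least half of
    the speed |b||y| remains. L + 1 avoids division by zero.\<close>
  define \<eta> where "\<eta> = min 1 (\<bar>b\<bar> * R / (2 * (L + 1)))"
  have \<eta>: "\<eta> > 0" "\<eta> \<le> 1" "L * \<eta> \<le> \<bar>b\<bar> / 2 * R"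
  proof -
    show "\<eta> > 0" using b_nz \<open>R > 0\<close> \<open>L \<ge> 0\<close> by (simp add: \<eta>_def)
    show "\<eta> \<le> 1" by (simp add: \<eta>_def)
    have "2 * (L + 1) > 0" using \<open>L \<ge> 0\<close> by simp
    moreover have "\<eta> \<le> \<bar>b\<bar> * R / (2 * (L + 1))" by (simp add: \<eta>_def)
    ultimately have "\<eta> * (2 * (L + 1)) \<le> \<bar>b\<bar> * R" by (simp only: pos_le_divide_eq)
    then show "L * \<eta> \<le> \<bar>b\<bar> / 2 * R" using \<open>\<eta> > 0\<close> by (simp add: algebra_simps)
  qed
  have Vb: "norm (V y s) \<le> \<bar>b\<bar> / 2 * norm y" if y: "norm y \<le> R + \<eta>" for y s
  proof (cases "norm y \<le> R")
    case True
    then show ?thesis by (simp add: zero')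
  next
    case False
    then have "y \<noteq> 0" using \<open>R > 0\<close> by auto
    \<comment> \<open>The radial projection of y onto the sphere of radius R, where V = 0.\<close>
    define z where "z = (R / norm y) *\<^sub>R y"
    have z: "norm z = R" using \<open>y \<noteq> 0\<close> \<open>R > 0\<close> by (simp add: z_def)
    have "y - z = (1 - R / norm y) *\<^sub>R y" by (simp add: z_def algebra_simps)
    then have "norm (y - z) = \<bar>1 - R / norm y\<bar> * norm y" by simp
    also have "\<dots> = norm y - R" using False \<open>y \<noteq> 0\<close> by (simp add: field_simps)
    finally have yz: "norm (y - z) \<le> \<eta>" using y by simp
    have "norm (V y s - V z s) \<le> L * norm (y - z)"
      by (rule V_lipschitz[of "cball 0 (R + 1)"]) (use N_le y z \<eta> in auto)
    also have "\<dots> \<le> L * \<eta>" using yz \<open>L \<ge> 0\<close> by (rule mult_left_mono)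
    also have "\<dots> \<le> \<bar>b\<bar> / 2 * R" by (rule \<eta>)
    also have "\<dots> \<le> \<bar>b\<bar> / 2 * norm y" using False by (intro mult_left_mono) auto
    finally show ?thesis using zero'[of z] z by simp
  qed
  have om0: "vorticity y s = 0" if "norm y < R" for y s
  proof -
    have "partial_y i (\<lambda>z. V z s) y = 0" for i
    proof -
      have "((\<lambda>z. V z s) has_derivative (\<lambda>_. 0)) (at y)"
        by (rule has_derivative_transform_within_open[OF has_derivative_const[of 0] open_ball[of 0 R]])
           (use that zero in auto)
      then have "(\<lambda>_. 0) = (\<lambda>h. advect h (\<lambda>z. V z s) y)"
        by (rule has_derivative_unique[OF _ V_derivative])
      then have "advect (axis i 1) (\<lambda>z. V z s) y = 0" by metis
      then show ?thesis by (simp add: advect_def axis_def if_distrib[of "\<lambda>x. x *\<^sub>R _"] cong: if_cong)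
    qed
    then show ?thesis using norm_curl_le[of "\<lambda>z. V z s" y] by (simp add: vorticity_def grad_norm_def)
  qed
  \<comment> \<open>Solves k|b|/2 = |a + b| + L + 1/2, which beats the worst possible growth rate at
    outward rate |b|/2.\<close>
  define k where "k = (2 * (\<bar>a + b\<bar> + L) + 1) / \<bar>b\<bar>"
  have k: "k \<ge> 0" "k * (\<bar>b\<bar> / 2) > \<bar>a + b\<bar> + L" using b_nz \<open>L \<ge> 0\<close> by (auto simp: k_def)
  have "vorticity y s = 0" if y: "norm y \<le> R + \<eta>" "y \<noteq> 0" for y s
  proof (rule vorticity_vanishes[of "\<bar>b\<bar> / 2" k L "R + \<eta>"])
    show "L - sgn b * (a + b) < k * (\<bar>b\<bar> / 2)"
    proof -
      have "\<bar>sgn b * (a + b)\<bar> = \<bar>a + b\<bar>" using b_nz by (simp add: abs_mult)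
      then show ?thesis using k by linarith
    qed
    show "gradV y s \<le> L" if "norm y \<le> R + \<eta>" for y s
      using N_le[of y s] that \<eta> by simp
    show "\<bar>b\<bar> / 2 * (y \<bullet> y) \<le> sgn b * ((b *\<^sub>R y + V y s) \<bullet> y)" if "norm y \<le> R + \<eta>" for y s
      by (rule outward[OF Vb[OF that]]) simp
    show "\<exists>r>0. \<forall>y s. norm y < r \<longrightarrow> vorticity y s \<bullet> vorticity y s * (y \<bullet> y) powr - k \<le> \<epsilon>" if "\<epsilon> > 0" for \<epsilon>
      using \<open>R > 0\<close> om0 that by (intro exI[of _ R]) auto
  qed (use b_nz k y in auto)
  then have "vorticity y s = 0" if "norm y < R + \<eta>" for y s
    using that om0[of y s] \<open>R > 0\<close> by (cases "y = 0") auto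
  then have "V y s = 0" if "norm y < R + \<eta>" for y s
    using div_curl_free_unique_continuation[OF div_curl_freeI \<open>R > 0\<close> zero that] by blast
  then show ?thesis using \<eta> by (intro exI[of _ "R + \<eta>"]) auto
qed

text \<open>The gain in radius in \<open>extend\<close> depends on R through the gradient bound L,
  so it cannot simply be iterated; a finite supremum of the good radii is contradicted
  instead.\<close>

lemma global:
  assumes "R > 0" and zero: "\<And>y s. norm y < R \<Longrightarrow> V y s = 0"
  shows "V y s = 0"
proof (rule ccontr)
  assume nz: "V y s \<noteq> 0"
  define M where "M = {m. 0 < m \<and> (\<forall>y s. norm y < m \<longrightarrow> V y s = 0)}"
  have RM: "R \<in> M" using assms by (simp add: M_def)
  then have ne: "M \<noteq> {}" by blast
  have bdd: "bdd_above M"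
  proof (rule bdd_aboveI)
    fix m assume "m \<in> M"
    then show "m \<le> norm y" using nz by (auto simp: M_def not_less[symmetric])
  qed
  have pos: "Sup M > 0" using cSup_upper[OF RM bdd] \<open>R > 0\<close> by linarith
  have zS: "V z t = 0" if less: "norm z < Sup M" for z t
  proof -
    obtain m where "m \<in> M" "norm z < m" using less_cSupD[OF ne less] by blast
    then show ?thesis by (simp add: M_def)
  qed
  obtain R' where "R' > Sup M" "\<forall>y s. norm y < R' \<longrightarrow> V y s = 0"
    using extend[OF pos zS] by blast
  then have "R' \<in> M" using pos by (simp add: M_def)
  then show False using cSup_upper[OF _ bdd] \<open>R' > Sup M\<close> by fastforce
qed

section \<open>From zero vorticity near the origin to V = 0, and the two sign cases\<close>

lemma V_zero_of_vorticity_zero: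
  assumes ext: "\<And>i s. s \<in> {0<..<S0} \<Longrightarrow> local_extremum (\<lambda>y. V y s $ i) 0"
    and V0: "\<And>s. V 0 s = 0" and "r > 0" and om0: "\<And>y s. norm y < r \<Longrightarrow> vorticity y s = 0"
  shows "V y s = 0"
proof (rule global[OF \<open>r > 0\<close>])
  fix y :: vec3 and s assume y: "norm y < r"
  have "V y s \<in> {0}"
  proof (rule periodic_closed[OF V_continuous S0_pos V_periodic])
    fix s assume s: "s \<in> {0<..<S0}"
    have "V y s = 0"
    proof (rule div_curl_free_eq_0[OF div_curl_freeI V0 _ y])
      fix e :: vec3 assume "e \<in> Basis"
      then obtain i where e: "e = axis i 1" by (auto simp: Basis_vec_def)
      show "(\<forall>\<^sub>F x in nhds 0. V x s \<bullet> e \<le> 0) \<or> (\<forall>\<^sub>F x in nhds 0. 0 \<le> V x s \<bullet> e)"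
        using ext[OF s, of i] V0[of s] by (simp add: local_extremum_def e inner_axis)
    qed (rule om0)
    then show "V y s \<in> {0}" by simp
  qed simp
  then show "V y s = 0" by simp
qed

text \<open>Fermat's rule for each component removes the whole spatial derivative at the origin;
  this is what makes the stretching rate small nearby.\<close>

lemma N0_of_local_extremum:
  assumes ext: "\<And>i s. s \<in> {0<..<S0} \<Longrightarrow> local_extremum (\<lambda>y. V y s $ i) 0"
  shows "gradV 0 s = 0"
proof -
  have "gradV 0 s \<in> {0}"
  proof (rule periodic_closed[OF gradV_continuous S0_pos gradV_periodic])
    fix s assume s: "s \<in> {0<..<S0}"
    have "advect h (\<lambda>z. V z s) 0 $ i = 0" for h i
    proof -
      have d: "((\<lambda>z. V z s $ i) has_derivative (\<lambda>h. advect h (\<lambda>z. V z s) 0 $ i)) (at 0)"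
        using bounded_linear.has_derivative[OF bounded_linear_vec_nth V_derivative] .
      obtain A where A: "open A" "0 \<in> A" "(\<forall>y\<in>A. V y s $ i \<le> V 0 s $ i) \<or> (\<forall>y\<in>A. V 0 s $ i \<le> V y s $ i)"
        using ext[OF s, of i] unfolding local_extremum_def eventually_nhds by blast
      from differential_zero_maxmin[OF A(2,1) d A(3)] show ?thesis by metis
    qed
    then have "advect h (\<lambda>z. V z s) 0 = 0" for h by (simp add: vec_eq_iff)
    then have "advect (axis i 1) (\<lambda>z. V z s) 0 = 0" for i by simp
    then have "partial_y i (\<lambda>z. V z s) 0 = 0" for i
      by (simp add: advect_def axis_def if_distrib[of "\<lambda>x. x *\<^sub>R _"] cong: if_cong)
    then show "gradV 0 s \<in> {0}" by (simp add: gradV_def grad_norm_def)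
  qed simp
  then show ?thesis by simp
qed

lemma V0_periodic:
  assumes "\<And>s. s \<in> {0<..<S0} \<Longrightarrow> V 0 s = 0"
  shows "V 0 s = 0"
  using periodic_closed[OF V_continuous S0_pos V_periodic, of "{0}" 0 s] assms by simp

lemma V_zero_of_same_sign:
  assumes ext: "\<And>i s. s \<in> {0<..<S0} \<Longrightarrow> local_extremum (\<lambda>y. V y s $ i) 0"
    and V0: "\<And>s. s \<in> {0<..<S0} \<Longrightarrow> V 0 s = 0"
    and rate: "0 < sgn b * (a + b)"
  shows "V y s = 0"
proof -
  have V0': "V 0 s = 0" for s by (rule V0_periodic[OF V0])
  have N0: "gradV 0 s = 0" for s by (rule N0_of_local_extremum[OF ext])
  have "\<exists>r>0. \<forall>y s. norm y < r \<longrightarrow> vorticity y s = 0"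
  \<comment> \<open>With k = 0 the weight is 1 away from the origin, so smallness is the continuity
    of \<Omega>, uniform in time, together with \<Omega> = 0 at the origin.\<close>
  proof (rule vorticity_vanishes_near_0[of 0])
    fix \<epsilon> :: real assume "\<epsilon> > 0"
    then have "sqrt \<epsilon> > 0" by simp
    obtain \<eta> where "\<eta> > 0" and \<eta>: "\<And>y z s. norm y \<le> 1 \<Longrightarrow> norm z \<le> 1 \<Longrightarrow> dist y z < \<eta> \<Longrightarrow> dist (vorticity y s) (vorticity z s) < sqrt \<epsilon>"
      using periodic_uniformly_continuous[OF vorticity_continuous S0_pos vorticity_periodic \<open>sqrt \<epsilon> > 0\<close>, of 1] by blast
    have om00: "vorticity 0 s = 0" for s
      using norm_curl_le[of "\<lambda>z. V z s" 0] N0[of s] by (simp add: vorticity_def gradV_def)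
    have "vorticity y s \<bullet> vorticity y s * (y \<bullet> y) powr - 0 \<le> \<epsilon>" if "norm y < min 1 \<eta>" for y s
    proof -
      have "norm (vorticity y s) < sqrt \<epsilon>" using \<eta>[of y 0 s] that by (simp add: om00)
      then have "vorticity y s \<bullet> vorticity y s \<le> \<epsilon>"
        unfolding norm_eq_sqrt_inner by simp
      then show ?thesis using \<open>\<epsilon> > 0\<close> by (cases "y = 0") auto
    qed
    then show "\<exists>r>0. \<forall>y s. norm y < r \<longrightarrow> vorticity y s \<bullet> vorticity y s * (y \<bullet> y) powr - 0 \<le> \<epsilon>"
      using \<open>\<eta> > 0\<close> by (intro exI[of _ "min 1 \<eta>"]) auto
  qed (use V0' N0 rate in auto)
  then obtain r where "r > 0" "\<And>y s. norm y < r \<Longrightarrow> vorticity y s = 0" by blast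
  then show ?thesis using V_zero_of_vorticity_zero[OF ext V0'] by blast
qed

lemma V_zero_of_flat:
  assumes ext: "\<And>i s. s \<in> {0<..<S0} \<Longrightarrow> local_extremum (\<lambda>y. V y s $ i) 0"
    and "\<rho> > 0" and \<beta>: "\<beta> > \<bar>a + b\<bar> / \<bar>b\<bar> + 2"
    and C: "C1_s_C_beta \<beta> V (ball 0 \<rho>) {0<..<S0}"
    and flat: "\<And>is s. length is \<le> nat \<lfloor>\<beta>\<rfloor> \<Longrightarrow> s \<in> {0<..<S0} \<Longrightarrow> partials_y is (\<lambda>y. V y s) 0 = 0"
  shows "V y s = 0"
proof -
  define n where "n = nat \<lfloor>\<beta>\<rfloor>"
  \<comment> \<open>The order to which the gradient of V vanishes at the origin. Since n > \<beta> -
    1, m still exceeds |a + b|/|b|.\<close>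
  define m where "m = n - 1"
  have ab: "\<bar>a + b\<bar> / \<bar>b\<bar> \<ge> 0" by simp
  have n: "real n > \<bar>a + b\<bar> / \<bar>b\<bar> + 1"
  proof -
    have "real n = of_int \<lfloor>\<beta>\<rfloor>" using \<beta> ab unfolding n_def by (intro of_nat_nat) linarith
    then show ?thesis using \<beta> by linarith
  qed
  then have "n > 1" using ab by linarith
  then have m: "real m > \<bar>a + b\<bar> / \<bar>b\<bar>" "1 + m = n" using n by (auto simp: m_def)
  \<comment> \<open>The midpoint of |a + b|/|b| and m: exceeding the former gives the sign of the
    rate, staying below the latter gives the smallness of |\<Omega>|^2 |y|^(-2k).\<close>
  define k where "k = (real m + \<bar>a + b\<bar> / \<bar>b\<bar>) / 2"
  have k: "k > \<bar>a + b\<bar> / \<bar>b\<bar>" "k < m" "k \<ge> 0"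
  proof -
    have "q < (r + q) / 2 \<and> (r + q) / 2 < r \<and> 0 \<le> (r + q) / 2" if "q < r" "0 \<le> q" for q r :: real
      using that by simp
    from this[OF m(1) ab] show "k > \<bar>a + b\<bar> / \<bar>b\<bar>" "k < m" "k \<ge> 0"
      unfolding k_def by blast+
  qed
  have sp: "spatial_C n V (ball 0 \<rho>) {0<..<S0}" "spatial_bounded n V (ball 0 \<rho>) {0<..<S0}"
    using C by (auto simp: C1_s_C_beta_def n_def)
  have V0: "V 0 s = 0" for s
    by (rule V0_periodic) (use flat[of "[]"] in simp)
  have N0: "gradV 0 s = 0" for s by (rule N0_of_local_extremum[OF ext])
  have "\<forall>i. \<exists>K\<ge>0. \<forall>y s. norm y < \<rho> \<longrightarrow> s \<in> {0<..<S0} \<longrightarrow> norm (partials_y [i] (\<lambda>z. V z s) y) \<le> K * norm y ^ m"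
    by (intro allI partials_y_flat[OF sp]) (use flat m in \<open>auto simp: n_def\<close>)
  then obtain K where K: "\<And>i. K i \<ge> 0"
    "\<And>i y s. norm y < \<rho> \<Longrightarrow> s \<in> {0<..<S0} \<Longrightarrow> norm (partial_y i (\<lambda>z. V z s) y) \<le> K i * norm y ^ m"
    by (metis partials_y.simps)
  define KK where "KK = (\<Sum>i\<in>UNIV. K i)"
  have "KK \<ge> 0" unfolding KK_def using K(1) by (intro sum_nonneg) auto
  have N_le: "gradV y s \<le> KK * norm y ^ m" if y: "norm y < \<rho>" for y s
  proof -
    have "gradV y s \<in> {..KK * norm y ^ m}"
    proof (rule periodic_closed[OF gradV_continuous S0_pos gradV_periodic])
      fix s assume "s \<in> {0<..<S0}"
      then show "gradV y s \<in> {..KK * norm y ^ m}"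
        using K(2)[OF y] by (auto simp: gradV_def grad_norm_def KK_def sum_distrib_right intro: sum_mono)
    qed auto
    then show ?thesis by simp
  qed
  have "\<exists>r>0. \<forall>y s. norm y < r \<longrightarrow> vorticity y s = 0"
  proof (rule vorticity_vanishes_near_0[of k, OF V0 N0 k(3)])
    have "\<bar>a + b\<bar> < k * \<bar>b\<bar>" using k(1) b_nz by (simp add: pos_divide_less_eq)
    moreover have "\<bar>sgn b * (a + b)\<bar> = \<bar>a + b\<bar>" using b_nz by (simp add: abs_mult)
    ultimately show "0 < sgn b * (a + b) + k * \<bar>b\<bar>" by linarith
  next
    fix \<epsilon> :: real assume "\<epsilon> > 0"
    \<comment> \<open>The weighted quantity is at most c |y|^e, and the second entry of
      \<open>r\<close> below solves c r^e = \<epsilon>.\<close>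
    define e where "e = 2 * (real m - k)"
    define c where "c = (6 * KK)\<^sup>2 + 1"
    have "e > 0" "c > 0" using k by (auto simp: e_def c_def add_nonneg_pos)
    define r where "r = min \<rho> ((\<epsilon> / c) powr (1 / e))"
    have "r > 0" using \<open>\<rho> > 0\<close> \<open>\<epsilon> > 0\<close> \<open>c > 0\<close> by (simp add: r_def)
    have "vorticity y s \<bullet> vorticity y s * (y \<bullet> y) powr - k \<le> \<epsilon>" if y: "norm y < r" for y s
    proof (cases "y = 0")
      case False
      have "norm (vorticity y s) \<le> 6 * gradV y s" unfolding vorticity_def gradV_def by (rule norm_curl_le)
      also have "\<dots> \<le> 6 * KK * norm y ^ m" using N_le[of y s] y by (simp add: r_def)
      finally have "norm (vorticity y s) \<le> 6 * KK * norm y ^ m" .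
      then have "(norm (vorticity y s))\<^sup>2 \<le> (6 * KK * norm y ^ m)\<^sup>2" by (intro power_mono) auto
      then have "vorticity y s \<bullet> vorticity y s \<le> (6 * KK)\<^sup>2 * (norm y ^ m)\<^sup>2"
        by (simp add: power2_norm_eq_inner power_mult_distrib)
      also have "\<dots> \<le> c * (norm y ^ m)\<^sup>2" unfolding c_def by (intro mult_right_mono) auto
      also have "(norm y ^ m)\<^sup>2 = norm y powr (2 * real m)"
        using powr_realpow[of "norm y" "2 * m"] False by (simp add: power_even_eq)
      finally have le: "vorticity y s \<bullet> vorticity y s * (y \<bullet> y) powr - k \<le> c * norm y powr (2 * real m) * (y \<bullet> y) powr - k"
        by (intro mult_right_mono) auto
      have pow: "(y \<bullet> y) powr - k = norm y powr (- 2 * k)"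
      proof -
        have "y \<bullet> y = norm y powr 2"
          using False by (simp add: powr_numeral dot_square_norm)
        then show ?thesis by (simp only: powr_powr) simp
      qed
      note le
      also have "c * norm y powr (2 * real m) * (y \<bullet> y) powr - k = c * norm y powr e"
        unfolding pow by (simp add: e_def powr_add[symmetric] algebra_simps)
      also have "\<dots> \<le> c * ((\<epsilon> / c) powr (1 / e)) powr e"
        using y \<open>c > 0\<close> \<open>e > 0\<close> by (intro mult_left_mono powr_mono2) (auto simp: r_def)
      also have "\<dots> = \<epsilon>" using \<open>e > 0\<close> \<open>c > 0\<close> \<open>\<epsilon> > 0\<close> by (simp add: powr_powr)
      finally show ?thesis .
    qed (use \<open>\<epsilon> > 0\<close> in simp)
    then show "\<exists>r>0. \<forall>y s. norm y < r \<longrightarrow> vorticity y s \<bullet> vorticity y s * (y \<bullet> y) powr - k \<le> \<epsilon>"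
      using \<open>r > 0\<close> by blast
  qed
  then obtain r where "r > 0" "\<And>y s. norm y < r \<Longrightarrow> vorticity y s = 0" by blast
  then show ?thesis using V_zero_of_vorticity_zero[OF ext V0] by blast
qed

end

theorem theorem1p2:
  fixes a b \<delta> S0 :: real
    and V :: "real^3 \<Rightarrow> real \<Rightarrow> real^3"
    and P :: "real^3 \<Rightarrow> real \<Rightarrow> real"
  assumes "b \<noteq> 0"
    and "0 < \<delta>" and "\<delta> < 1"
    and "S0 > 0"
    and "C1_s_C1_holder \<delta> V"
    and "C1_spacetime (\<lambda>y s. curl (\<lambda>z. V z s) y)"
    and "time_periodic_solution a b S0 V P"
    and case_i: "(a + b > 0 \<and> b > 0) \<or> (a + b < 0 \<and> b < 0) \<Longrightarrow>
        (\<forall>i. \<forall>s\<in>{0<..<S0}. local_extremum (\<lambda>y. V y s $ i) 0) \<and>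
        (\<forall>s\<in>{0<..<S0}. V 0 s = 0)"
    and case_ii: "(a + b \<le> 0 \<and> b > 0) \<or> (a + b \<ge> 0 \<and> b < 0) \<Longrightarrow>
        (\<forall>i. \<forall>s\<in>{0<..<S0}. local_extremum (\<lambda>y. V y s $ i) 0) \<and>
        (\<exists>\<rho> > 0. \<exists>\<beta> > \<bar>a + b\<bar> / \<bar>b\<bar> + 2.
           C1_s_C_beta \<beta> V (ball 0 \<rho>) {0<..<S0} \<and>
           (\<forall>k \<le> nat \<lfloor>\<beta>\<rfloor>. \<forall>is. length is = k \<longrightarrow>
              (\<forall>s\<in>{0<..<S0}. partials_y is (\<lambda>y. V y s) 0 = 0)))"
  shows "\<forall>y s. V y s = 0"
proof -
  interpret euler_periodic a b \<delta> S0 V P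
    by unfold_locales (fact assms)+
  show ?thesis
  proof (cases "(a + b > 0 \<and> b > 0) \<or> (a + b < 0 \<and> b < 0)")
    case True
    then have "0 < sgn b * (a + b)" by auto
    then show ?thesis using case_i[OF True] V_zero_of_same_sign by blast
  next
    case False
    then have "(a + b \<le> 0 \<and> b > 0) \<or> (a + b \<ge> 0 \<and> b < 0)" using \<open>b \<noteq> 0\<close> by linarith
    note hyp = case_ii[OF this]
    from conjunct2[OF hyp] obtain \<rho> \<beta> where \<rho>: "\<rho> > 0" and \<beta>: "\<beta> > \<bar>a + b\<bar> / \<bar>b\<bar> + 2"
      and C: "C1_s_C_beta \<beta> V (ball 0 \<rho>) {0<..<S0}"
      and flat: "\<forall>k \<le> nat \<lfloor>\<beta>\<rfloor>. \<forall>is. length is = k \<longrightarrow> (\<forall>s\<in>{0<..<S0}. partials_y is (\<lambda>y. V y s) 0 = 0)"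
      by blast
    have "V y s = 0" for y s
      by (rule V_zero_of_flat[OF _ \<rho> \<beta> C]) (use conjunct1[OF hyp] flat in auto)
    then show ?thesis by simp
  qed
qed

end
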